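(* Let $\Bbbk$ be a field and $N\ge3$. With $\mathbf t_k$ and $e_{IJ}$ as defined in the context, the set of monomials $$\{1\}\cup\{\mathbf t_k^{\ell}\,e_{IJ}\mid \ell\in\mathbb Z_{\ge0},\ 1\le|I|=|J|=k\le N-1\}$$ (with $I,J$ ranging over increasing sequences, i.e. subsets of $\{1,\dots,N\}$) defines a $\Bbbk$-basis of the affine nilTemperley-Lieb algebra $\mathrm{n}\widehat{\mathrm{TL}}_N$. In particular, it is part of the assertion that each element $\mathbf t_k^{\ell}\,e_{IJ}$ with $|I|=|J|=k$ is a monomial in $\mathrm{n}\widehat{\mathrm{TL}}_N$.
   Context: The affine nilTemperley-Lieb algebra $\mathrm{n}\widehat{\mathrm{TL}}_N$ ($N\ge3$) is the unital associative $\Bbbk$-algebra with generators $a_0,\dots,a_{N-1}$ and relations $a_i^2=0$, $a_ia_j=a_ja_i$ for $i-j\not\equiv\pm1 \pmod N$, and $a_ia_{i+1}a_i=a_{i+1}a_ia_{i+1}=0$ for all $i$, all indices modulo $N$ (so $a_N=a_0$). Monomials are products $a_{j_1}\cdots a_{j_m}$ of generators. Representation: let $v_1,\dots,v_N$ be a basis of $\Bbbk^N$ and $\mathsf V=\bigoplus_{k=0}^N\big(\Bbbk[q]\otimes_{\Bbbk}\bigwedge^k\Bbbk^N\big)$, with $\Bbbk[q]$-basis $v(I)=v_{i_1}\wedge\dots\wedge v_{i_k}$ for $I=\{1\le i_1<\dots<i_k\le N\}$, viewed as $k$ particles at positions $I$ on a circle with $N$ positions (positions $0$ and $N$ identified).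 The algebra acts (faithfully) and $\Bbbk[q]$-linearly: for $1\le j\le N-1$, $a_jv(I)$ is obtained by replacing $v_j$ by $v_{j+1}$ in the wedge if $j\in I$, and $a_jv(I)=0$ if $j\notin I$; $a_0v(I)=q\cdot v_{i_1}\wedge\dots\wedge v_{i_{k-1}}\wedge v_1$ if $i_k=N$, and $a_0v(I)=0$ otherwise. Thus $a_j$ moves a particle from position $j$ to $j+1$ (and gives $0$ if there is no particle at $j$ or there is one at $j+1$). For $I=\{1\le i_1<\dots<i_k\le N\}$ with $1\le k\le N-1$, choose $\ell\in\{1,\dots,k\}$ with $i_\ell+1<i_{\ell+1}$, where $i_{k+1}:=i_1+N$, and define $$a(\hat I)=(a_{i_1-1}a_{i_1-2}\cdots a_{i_k+1})\cdot\prod_{s=1}^{k-1}(a_{i_{s+1}-1}a_{i_{s+1}-2}\cdots a_{i_s+1})\cdot(a_{i_{\ell+1}}\cdots a_{i_k})\cdot(a_{i_1}\cdots a_{i_\ell}),$$ indices modulo $N$; the first factor has indices $i_1+N-1,\dots,i_k+1$ reduced modulo $N$, and empty products are $1$. The element $a(\hat I)$ depends only on $I$. Set $\mathbf t_k=(-1)^{k-1}\sum_{|I|=k}a(\hat I)$ for $1\le k\le N-1$. For $I,J\subseteq\{1,\dots,N\}$ with $1\le|I|=|J|\le N-1$: if $I=J$, set $e_{II}=a(\hat I)$. If $I\ne J$, $e_{IJ}$ is the monomial which moves the particles at positions $J$ to positions $I$ such that every particle of $J$ is moved by at least one step (i.e. $e_{IJ}v(J)=\pm q^{r}v(I)$ and,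 for every $j\in J$, the generator $a_j$ occurs in $e_{IJ}$) and such that, among all monomials with this property, the exponent $r$ is minimal. As an element of the algebra, $e_{IJ}$ is uniquely determined by these conditions. (It is not prescribed which particle of $J$ goes to which position of $I$.)
   Formalization: Each t_k^l e_IJ is shown to be (−1)^((k−1)l) times a monomial, since with the sign in t_k it is not literally a product of generators when (k−1)l is odd and char k ≠ 2 (e.g. N=3, I=J={1,2}: t_2 e_II = −(a_0a_1a_2)^2). *)

theory Defs
  imports
    "HOL-Library.Poly_Mapping"
    "HOL-Computational_Algebra.Polynomial"
    "Berlekamp_Zassenhaus.Finite_Field"
begin

section \<open>The free algebra on the letters \<open>\<int>/N\<close>\<close>

text \<open>
  Words form the free monoid, written additively so that \<open>'i fword \<Rightarrow>\<^sub>0 'k\<close>,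
  with the convolution product of \<^theory>\<open>HOL-Library.Poly_Mapping\<close>,
  is the free associative unital \<open>'k\<close>-algebra on the set of letters \<open>'i\<close>.
\<close>

datatype 'i fword = FWord (letters: "'i list")

instantiation fword :: (type) monoid_add
begin

definition zero_fword :: "'a fword" where
  "0 = FWord []"

definition plus_fword :: "'a fword \<Rightarrow> 'a fword \<Rightarrow> 'a fword" where
  "u + v = FWord (letters u @ letters v)"

instance
  by standard (simp_all add: zero_fword_def plus_fword_def)

end

lemma fword_add_eq_0_iff: "u + v = 0 \<longleftrightarrow> u = 0 \<and> v = (0 :: 'i fword)"
  by (cases u; cases v) (auto simp: zero_fword_def plus_fword_def)

definition free_gen :: "'i \<Rightarrow> ('i fword \<Rightarrow>\<^sub>0 'k::field)" where
  "free_gen i = Poly_Mapping.single (FWord [i]) 1"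


section \<open>The affine nilTemperley-Lieb algebra\<close>

text \<open>
  The index set \<open>\<int>/N\<close> is the type \<open>'n mod_ring\<close> with \<open>N = CARD('n)\<close>, so that
  \<open>i + 1\<close> below is addition modulo \<open>N\<close>.
\<close>

definition nTL_rels :: "('n::nontriv mod_ring fword \<Rightarrow>\<^sub>0 'k::field) set" where
  "nTL_rels =
     {free_gen i * free_gen i | i. True}
   \<union> {free_gen i * free_gen j - free_gen j * free_gen i | i j. i - j \<noteq> 1 \<and> i - j \<noteq> - 1}
   \<union> {free_gen i * free_gen (i + 1) * free_gen i | i. True}
   \<union> {free_gen (i + 1) * free_gen i * free_gen (i + 1) | i. True}"

inductive_set nTL_ideal :: "('n::nontriv mod_ring fword \<Rightarrow>\<^sub>0 'k::field) set" where
  zero: "0 \<in> nTL_ideal"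
| rel: "r \<in> nTL_rels \<Longrightarrow> x * r * y \<in> nTL_ideal"
| add: "x \<in> nTL_ideal \<Longrightarrow> y \<in> nTL_ideal \<Longrightarrow> x + y \<in> nTL_ideal"

lemma nTL_ideal_mult_left: "x \<in> nTL_ideal \<Longrightarrow> z * x \<in> nTL_ideal"
proof (induction rule: nTL_ideal.induct)
  case (rel r x y)
  then show ?case
    using nTL_ideal.rel[of r "z * x" y] by (simp add: mult.assoc)
qed (simp_all add: nTL_ideal.intros distrib_left)

lemma nTL_ideal_mult_right: "x \<in> nTL_ideal \<Longrightarrow> x * z \<in> nTL_ideal"
proof (induction rule: nTL_ideal.induct)
  case (rel r x y)
  then show ?case
    using nTL_ideal.rel[of r x "y * z"] by (simp add: mult.assoc)
qed (simp_all add: nTL_ideal.intros distrib_right)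

lemma nTL_ideal_uminus: "x \<in> nTL_ideal \<Longrightarrow> - x \<in> nTL_ideal"
  using nTL_ideal_mult_left[of x "- 1"] by simp

lemma nTL_ideal_diff: "x \<in> nTL_ideal \<Longrightarrow> y \<in> nTL_ideal \<Longrightarrow> x - y \<in> nTL_ideal"
  using nTL_ideal.add[of x "- y"] nTL_ideal_uminus[of y] by simp

lemma lookup_times_0:
  fixes x y :: "'i fword \<Rightarrow>\<^sub>0 'k::field"
  shows "Poly_Mapping.lookup (x * y) 0 = Poly_Mapping.lookup x 0 * Poly_Mapping.lookup y 0"
proof -
  let ?x = "Poly_Mapping.lookup x" and ?y = "Poly_Mapping.lookup y"
  have "Poly_Mapping.lookup (x * y) 0 = Sum_any (\<lambda>l. ?x l * Sum_any (\<lambda>r. ?y r when 0 = l + r))"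
    by (simp add: times_poly_mapping.rep_eq prod_fun_def)
  also have "\<dots> = Sum_any (\<lambda>l. ?x l * ?y 0 when l = 0)"
  proof (rule Sum_any.cong)
    fix l :: "'i fword"
    have "(?y r when 0 = l + r) = ((?y r when l = 0) when r = 0)" for r
      by (metis fword_add_eq_0_iff when_def)
    then have "Sum_any (\<lambda>r. ?y r when 0 = l + r) = (?y 0 when l = 0)"
      by simp
    then show "?x l * Sum_any (\<lambda>r. ?y r when 0 = l + r) = (?x l * ?y 0 when l = 0)"
      by (simp add: when_def)
  qed
  also have "\<dots> = ?x 0 * ?y 0"
    by simp
  finally show ?thesis .
qed

lemma nTL_ideal_lookup_0: "x \<in> nTL_ideal \<Longrightarrow> Poly_Mapping.lookup x 0 = 0"
proof (induction rule: nTL_ideal.induct)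
  case (rel r x y)
  have "Poly_Mapping.lookup (free_gen i) 0 = (0 :: 'b::field)" for i :: "'a::nontriv mod_ring"
    by (simp add: free_gen_def lookup_single zero_fword_def)
  then have "Poly_Mapping.lookup r 0 = 0"
    using rel by (auto simp: nTL_rels_def lookup_times_0 lookup_minus)
  then show ?case
    by (simp add: lookup_times_0)
qed (simp_all add: lookup_add)

lemma one_notin_nTL_ideal: "1 \<notin> nTL_ideal"
  using nTL_ideal_lookup_0[of 1] by (auto simp: lookup_one)

definition nTL_rel ::
  "('n::nontriv mod_ring fword \<Rightarrow>\<^sub>0 'k::field) \<Rightarrow> ('n mod_ring fword \<Rightarrow>\<^sub>0 'k) \<Rightarrow> bool" where
  "nTL_rel x y \<longleftrightarrow> x - y \<in> nTL_ideal"

lemma equivp_nTL_rel: "equivp nTL_rel"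
proof (intro equivpI reflpI sympI transpI)
  fix x y z :: "'n::nontriv mod_ring fword \<Rightarrow>\<^sub>0 'k::field"
  show "nTL_rel x x"
    by (simp add: nTL_rel_def nTL_ideal.zero)
  show "nTL_rel y x" if "nTL_rel x y"
    using nTL_ideal_uminus[of "x - y"] that by (simp add: nTL_rel_def)
  show "nTL_rel x z" if "nTL_rel x y" "nTL_rel y z"
    using nTL_ideal.add[of "x - y" "y - z"] that by (simp add: nTL_rel_def)
qed

quotient_type (overloaded) ('k, 'n) nTL =
  "'n::nontriv mod_ring fword \<Rightarrow>\<^sub>0 'k::field" / nTL_rel
  by (rule equivp_nTL_rel)

instantiation nTL :: (field, nontriv) ring_1
begin

lift_definition zero_nTL :: "('a, 'b) nTL" is 0 .

lift_definition one_nTL :: "('a, 'b) nTL" is 1 .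

lift_definition plus_nTL :: "('a, 'b) nTL \<Rightarrow> ('a, 'b) nTL \<Rightarrow> ('a, 'b) nTL" is "(+)"
proof -
  fix x x' y y' :: "'b mod_ring fword \<Rightarrow>\<^sub>0 'a"
  assume "nTL_rel x x'" "nTL_rel y y'"
  then show "nTL_rel (x + y) (x' + y')"
    using nTL_ideal.add[of "x - x'" "y - y'"] by (simp add: nTL_rel_def algebra_simps)
qed

lift_definition uminus_nTL :: "('a, 'b) nTL \<Rightarrow> ('a, 'b) nTL" is uminus
proof -
  fix x x' :: "'b mod_ring fword \<Rightarrow>\<^sub>0 'a"
  assume "nTL_rel x x'"
  then show "nTL_rel (- x) (- x')"
    using nTL_ideal_uminus[of "x - x'"] by (simp add: nTL_rel_def)
qed

lift_definition minus_nTL :: "('a, 'b) nTL \<Rightarrow> ('a, 'b) nTL \<Rightarrow> ('a, 'b) nTL" is "(-)"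
proof -
  fix x x' y y' :: "'b mod_ring fword \<Rightarrow>\<^sub>0 'a"
  assume "nTL_rel x x'" "nTL_rel y y'"
  then show "nTL_rel (x - y) (x' - y')"
    using nTL_ideal_diff[of "x - x'" "y - y'"] by (simp add: nTL_rel_def algebra_simps)
qed

lift_definition times_nTL :: "('a, 'b) nTL \<Rightarrow> ('a, 'b) nTL \<Rightarrow> ('a, 'b) nTL" is "(*)"
proof -
  fix x x' y y' :: "'b mod_ring fword \<Rightarrow>\<^sub>0 'a"
  assume "nTL_rel x x'" "nTL_rel y y'"
  then have "(x - x') * y + x' * (y - y') \<in> nTL_ideal"
    unfolding nTL_rel_def
    by (intro nTL_ideal.add nTL_ideal_mult_left nTL_ideal_mult_right)
  then show "nTL_rel (x * y) (x' * y')"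
    by (simp add: nTL_rel_def algebra_simps)
qed

instance
proof
  fix x y z :: "('a, 'b) nTL"
  have eq: "nTL_rel u v" if "u = v" for u v :: "'b mod_ring fword \<Rightarrow>\<^sub>0 'a"
    using that by (simp add: nTL_rel_def nTL_ideal.zero)
  show "x + y + z = x + (y + z)" by transfer (simp add: eq algebra_simps)
  show "x + y = y + x" by transfer (simp add: eq algebra_simps)
  show "0 + x = x" by transfer (simp add: eq)
  show "- x + x = 0" by transfer (simp add: eq)
  show "x - y = x + - y" by transfer (simp add: eq)
  show "x * y * z = x * (y * z)" by transfer (simp add: eq mult.assoc)
  show "(x + y) * z = x * z + y * z" by transfer (simp add: eq algebra_simps)
  show "x * (y + z) = x * y + x * z" by transfer (simp add: eq algebra_simps)
  show "1 * x = x" by transfer (simp add: eq)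
  show "x * 1 = x" by transfer (simp add: eq)
  have "\<not> nTL_rel 0 (1 :: 'b mod_ring fword \<Rightarrow>\<^sub>0 'a)"
    using nTL_ideal_uminus[of "- 1 :: 'b mod_ring fword \<Rightarrow>\<^sub>0 'a"] one_notin_nTL_ideal
    by (auto simp: nTL_rel_def)
  then show "(0 :: ('a, 'b) nTL) \<noteq> 1"
    by transfer
qed

end

lift_definition nTL_scale :: "'k::field \<Rightarrow> ('k, 'n::nontriv) nTL \<Rightarrow> ('k, 'n) nTL"
  is "\<lambda>c x. Poly_Mapping.single 0 c * x"
  by (simp add: nTL_rel_def nTL_ideal_mult_left flip: right_diff_distrib)

global_interpretation nTL: vector_space "nTL_scale :: 'k::field \<Rightarrow> ('k, 'n::nontriv) nTL \<Rightarrow> _"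
proof
  fix a b :: 'k and x y :: "('k, 'n) nTL"
  have eq: "nTL_rel u v" if "u = v" for u v :: "'n mod_ring fword \<Rightarrow>\<^sub>0 'k"
    using that by (simp add: nTL_rel_def nTL_ideal.zero)
  show "nTL_scale a (x + y) = nTL_scale a x + nTL_scale a y"
    by transfer (simp add: eq distrib_left)
  show "nTL_scale (a + b) x = nTL_scale a x + nTL_scale b x"
    by transfer (simp add: eq single_add distrib_right)
  show "nTL_scale a (nTL_scale b x) = nTL_scale (a * b) x"
    by transfer (simp add: eq mult_single flip: mult.assoc)
  show "nTL_scale 1 x = x"
    by transfer (simp add: eq)
qed

definition nTL_gen :: "'n::nontriv mod_ring \<Rightarrow> ('k::field, 'n) nTL" where
  "nTL_gen i = abs_nTL (free_gen i)"

definition nTL_monom :: "'n::nontriv mod_ring list \<Rightarrow> ('k::field, 'n) nTL" where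
  "nTL_monom w = prod_list (map nTL_gen w)"


section \<open>The representation on \<open>K[q] \<otimes> \<Lambda>(K\<^sup>N)\<close>\<close>

text \<open>
  Vectors are finite \<open>K[q]\<close>-combinations of the basis vectors \<open>v(I)\<close>; the representation
  space is spanned by those with \<open>I \<subseteq> {1..N}\<close>, and the operators below preserve that span.
\<close>

type_synonym 'k particle_space = "nat set \<Rightarrow>\<^sub>0 'k poly"

definition pvec :: "nat set \<Rightarrow> 'k::field particle_space" where
  "pvec I = Poly_Mapping.single I 1"

definition pscale :: "'k::field poly \<Rightarrow> 'k particle_space \<Rightarrow> 'k particle_space" where
  "pscale p x = Poly_Mapping.map ((*) p) x"

definition qvar :: "'k::field poly" where
  "qvar = [:0, 1:]"

definition inversions :: "nat list \<Rightarrow> nat" where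
  "inversions xs = card {(p, r). p < r \<and> r < length xs \<and> xs ! r < xs ! p}"

text \<open>\<open>wedge [x\<^sub>1, \<dots>, x\<^sub>m]\<close> is \<open>v\<^bsub>x\<^sub>1\<^esub> \<and> \<dots> \<and> v\<^bsub>x\<^sub>m\<^esub>\<close> expanded in the basis \<open>v(I)\<close>.\<close>

definition wedge :: "nat list \<Rightarrow> 'k::field particle_space" where
  "wedge xs =
     (if distinct xs then pscale ((- 1) ^ inversions xs) (pvec (set xs)) else 0)"

definition act_basis :: "nat \<Rightarrow> nat \<Rightarrow> nat set \<Rightarrow> 'k::field particle_space" where
  "act_basis N j I =
     (let xs = sorted_list_of_set I in
      if j = 0
      then (if N \<in> I then pscale qvar (wedge (butlast xs @ [1])) else 0)
      else (if j \<in> I then wedge (map (\<lambda>i. if i = j then j + 1 else i) xs) else 0))"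

definition act_gen :: "'n::nontriv mod_ring \<Rightarrow> 'k::field particle_space \<Rightarrow> 'k particle_space" where
  "act_gen i x =
     (\<Sum>I\<in>Poly_Mapping.keys x. pscale (Poly_Mapping.lookup x I) (act_basis CARD('n) (nat (to_int_mod_ring i)) I))"

text \<open>The rightmost letter of a word acts first.\<close>

definition act_word ::
  "'n::nontriv mod_ring list \<Rightarrow> 'k::field particle_space \<Rightarrow> 'k particle_space" where
  "act_word w x = foldr act_gen w x"


section \<open>The elements \<open>a(I)\<close>, \<open>t\<^sub>k\<close> and \<open>e\<^sub>I\<^sub>J\<close>\<close>

definition subsets_of_card :: "nat \<Rightarrow> nat \<Rightarrow> nat set set" where
  "subsets_of_card N k = {I. I \<subseteq> {1..N} \<and> card I = k}"

text \<open>The 1-based enumeration \<open>i\<^sub>1 < \<dots> < i\<^sub>k\<close> of \<open>I\<close>, extended by \<open>i\<^bsub>k+1\<^esub> = i\<^sub>1 + N\<close>.\<close>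

definition pos :: "nat \<Rightarrow> nat set \<Rightarrow> nat \<Rightarrow> nat" where
  "pos N I s =
     (if s = card I + 1 then sorted_list_of_set I ! 0 + N else sorted_list_of_set I ! (s - 1))"

definition gap_index :: "nat \<Rightarrow> nat set \<Rightarrow> nat \<Rightarrow> bool" where
  "gap_index N I l \<longleftrightarrow> l \<in> {1..card I} \<and> pos N I l + 1 < pos N I (l + 1)"

text \<open>The word of \<open>a(I)\<close>; its letters are to be reduced modulo \<open>N\<close>.\<close>

definition ahat_word :: "nat \<Rightarrow> nat set \<Rightarrow> nat \<Rightarrow> nat list" where
  "ahat_word N I l =
     (let k = card I; i = pos N I in
      rev [i k + 1 ..< i 1 + N]
      @ concat (map (\<lambda>s. rev [i s + 1 ..< i (s + 1)]) [1..<k])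
      @ map i [l + 1..<k + 1]
      @ map i [1..<l + 1])"

definition ahat :: "nat set \<Rightarrow> ('k::field, 'n::nontriv) nTL" where
  "ahat I = nTL_monom (map of_nat (ahat_word CARD('n) I (SOME l. gap_index CARD('n) I l)))"

text \<open>
  Each \<open>a(I)\<close> is a monomial with \<open>a(I) v(I) = (-1)\<^bsup>k-1\<^esup> q v(I)\<close>, and
  \<open>t\<^sub>k e\<^sub>I\<^sub>J = (-1)\<^bsup>k-1\<^esup> a(I) e\<^sub>I\<^sub>J\<close>; hence \<open>t\<^sub>k\<^sup>l e\<^sub>I\<^sub>J\<close> is \<open>(-1)\<^bsup>(k-1)l\<^esup>\<close> times a monomial.
\<close>

definition tk :: "nat \<Rightarrow> ('k::field, 'n::nontriv) nTL" where
  "tk k = (- 1) ^ (k - 1) * (\<Sum>I\<in>subsets_of_card CARD('n) k. ahat I)"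

text \<open>
  \<open>moves TYPE('k) I J r w\<close>: the monomial of the word \<open>w\<close> sends \<open>v(J)\<close> to \<open>\<plusminus>q\<^sup>r v(I)\<close> and
  moves every particle of \<open>J\<close>. The monomial of a word acts by composition of the operators of
  its letters.
\<close>

definition moves ::
  "'k::field itself \<Rightarrow> nat set \<Rightarrow> nat set \<Rightarrow> nat \<Rightarrow> 'n::nontriv mod_ring list \<Rightarrow> bool" where
  "moves _ I J r w \<longleftrightarrow>
     (act_word w (pvec J) = pscale (qvar ^ r) (pvec I :: 'k particle_space) \<or>
      act_word w (pvec J) = - pscale (qvar ^ r) (pvec I :: 'k particle_space)) \<and>
     (\<forall>j\<in>J. of_nat j \<in> set w)"

definition eIJ :: "nat set \<Rightarrow> nat set \<Rightarrow> ('k::field, 'n::nontriv) nTL" where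
  "eIJ I J =
     (if I = J then ahat I
      else THE x. \<exists>w r. x = nTL_monom w \<and> moves TYPE('k) I J r w \<and>
             (\<forall>w' r'. moves TYPE('k) I J r' (w' :: 'n mod_ring list) \<longrightarrow> r \<le> r'))"

end

theory Submission
  imports Defs
begin

text \<open>
  A letter \<open>i\<close> of \<open>\<int>/N\<close> moves a particle from site \<open>i\<close> to site \<open>i + 1\<close>, provided that
  \<open>i\<close> is occupied and \<open>i + 1\<close> is free; a word is executed from right to left. Up to signs and
  powers of \<open>q\<close>, this motion on subsets of \<open>\<int>/N\<close> is the representation on \<open>K[q] \<otimes> \<Lambda>(K\<^sup>N)\<close>,
  the power of \<open>q\<close> counting the occurrences of the letter \<open>0\<close>. All relations of the algebra equate
  monomials or kill them, so the task is to classify the nonzero monomials. A word is assigned the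
  \<^emph>\<open>type\<close> \<open>(X, Y, r)\<close> if it leads from the configuration \<open>X\<close> to \<open>Y\<close>, moves every particle of \<open>X\<close>,
  and contains the letter \<open>0\<close> exactly \<open>r\<close> times.

  \<^item> A word has at most one type (\<open>has_type_inject\<close>), because the word itself dictates the
    initial occupation of every site that it touches (\<open>run_sites_agree\<close>).
  \<^item> Words of the same type give the same monomial (\<open>run_monom_determined\<close>). Particle conservation
    at each site turns \<open>(X, Y, r)\<close> into the number of occurrences of each letter, and two executable
    words from \<open>X\<close> with the same letters can be matched by commutations alone: the first move of one
    word can always be pulled to the front of the other.
  \<^item> A word without a type represents \<open>0\<close> (\<open>nTL_monom_nonzero_imp_run\<close>). Add letters on the left
    one at a time, always keeping the smallest starting configuration. If the new letter cannot be
    executed, even after placing one more particle, then it meets an earlier copy of itself with at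
    most one neighbouring letter in between, and the relations make the product vanish.

  The rule that sums the coefficients of all words of a given type respects the relations, hence is
  a linear functional on the algebra. These functionals separate monomials of different types, which
  gives linear independence, while the three facts above give spanning: the nonzero monomials form a
  basis indexed by the types that occur; the unit has the type \<open>({}, {}, 0)\<close>.

  It remains to see which types occur and to recognise the elements \<open>t\<^sub>k\<^sup>l e\<^sub>I\<^sub>J\<close>. The word
  of \<open>a(I)\<close> uses every letter once and pushes each particle of \<open>I\<close> to the starting site of the next one
  (\<open>ahat_word_loop\<close>). Since there are such loops, motion is reversible, so any two configurations
  with the same number of particles are connected (\<open>has_type_exists\<close>), and \<open>e\<^sub>I\<^sub>J\<close> is the monomial of
  type \<open>(J, I, r)\<close> with the least possible \<open>r\<close> (\<open>eIJ_has_type\<close>). Left multiplication by \<open>t\<^sub>k\<close> picks out the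
  single summand \<open>a(I)\<close> and raises \<open>r\<close> by one (\<open>tk_mult_monom\<close>). Therefore \<open>t\<^sub>k\<^sup>l e\<^sub>I\<^sub>J\<close>, for
  \<open>l = 0, 1, \<dots>\<close>, runs up to sign through all monomials of type \<open>(J, I, \<dots>)\<close>.
\<close>


section \<open>Residues modulo N\<close>

lemma of_nat_mod_ring_eq_iff:
  "(of_nat a :: 'n::nontriv mod_ring) = of_nat b \<longleftrightarrow> a mod CARD('n) = b mod CARD('n)"
proof -
  have "(of_nat a :: 'n mod_ring) = of_nat b \<longleftrightarrow> int a mod int CARD('n) = int b mod int CARD('n)"
    by transfer simp
  then show ?thesis by (metis of_nat_eq_iff zmod_int)
qed

lemma mod_ring_two_neq_0:
  "CARD('n) \<ge> 3 \<Longrightarrow> (1 + 1 :: 'n::nontriv mod_ring) \<noteq> 0"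
  using of_nat_mod_ring_eq_iff[of 2 0, where 'n='n] by simp

lemma mod_ring_eq_of_nat:
  fixes i :: "'n::nontriv mod_ring"
  obtains n where "n < CARD('n)" "i = of_nat n"
proof
  have r: "to_int_mod_ring i \<in> {0..<CARD('n)}"
    using range_to_int_mod_ring[where 'a='n] by blast
  then show "nat (to_int_mod_ring i) < CARD('n)" by (simp add: nat_less_iff)
  show "i = of_nat (nat (to_int_mod_ring i))"
    using r by (simp add: of_nat_of_int_mod_ring)
qed

text \<open>
  The indices of the word of \<open>a(I)\<close> are natural numbers in a window of length \<open>N\<close> that starts at
  \<open>i\<^sub>1\<close>. Such a window represents each residue once, and residues are neighbours if their
  representatives are, or if these are the two ends of the window.
\<close>

lemma inj_on_of_nat_window:
  "inj_on (of_nat :: nat \<Rightarrow> 'n::nontriv mod_ring) {a..<a + CARD('n)}"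
proof (rule linorder_inj_onI)
  fix x y assume xy: "x < y" "x \<in> {a..<a + CARD('n)}" "y \<in> {a..<a + CARD('n)}"
  show "(of_nat x :: 'n mod_ring) \<noteq> of_nat y"
  proof
    assume "(of_nat x :: 'n mod_ring) = of_nat y"
    then have "CARD('n) dvd y - x"
      using xy(1) by (simp add: of_nat_mod_ring_eq_iff mod_eq_dvd_iff_nat[symmetric])
    from dvd_imp_le[OF this] xy show False by auto
  qed
qed auto

lemma of_nat_window_eq_Suc:
  assumes "x \<in> {a..<a + CARD('n::nontriv)}" "z \<in> {a..<a + CARD('n)}"
    "(of_nat z :: 'n mod_ring) = of_nat x + 1"
  shows "z = x + 1 \<or> z + CARD('n) = x + 1"
proof (cases "x + 1 < a + CARD('n)")
  case True
  moreover have "(of_nat z :: 'n mod_ring) = of_nat (x + 1)"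
    using assms(3) by simp
  ultimately show ?thesis
    using inj_onD[OF inj_on_of_nat_window[where 'n='n, of a], of z "x + 1"] assms(1,2) by auto
next
  case False
  then have x: "x + 1 = a + CARD('n)" using assms(1) by auto
  have "(of_nat z :: 'n mod_ring) = of_nat (x + 1)"
    using assms(3) by simp
  then have "(of_nat z :: 'n mod_ring) = of_nat a"
    unfolding x by simp
  then show ?thesis
    using inj_onD[OF inj_on_of_nat_window[where 'n='n, of a], of z a] assms(1,2) x by auto
qed

lemma of_nat_window_surj: "(of_nat :: nat \<Rightarrow> 'n::nontriv mod_ring) ` {a..<a + CARD('n)} = UNIV"
proof (rule card_subset_eq)
  show "card ((of_nat :: nat \<Rightarrow> 'n mod_ring) ` {a..<a + CARD('n)}) = CARD('n mod_ring)"
    by (simp add: card_image[OF inj_on_of_nat_window])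
qed auto


section \<open>Particle configurations on the circle\<close>

text \<open>
  \<open>None\<close> is the zero vector: an illegal move kills the configuration.
\<close>

definition hop :: "'n::nontriv mod_ring \<Rightarrow> 'n mod_ring set \<Rightarrow> 'n mod_ring set option" where
  "hop i X = (if i \<in> X \<and> i + 1 \<notin> X then Some (insert (i + 1) (X - {i})) else None)"

primrec run :: "'n::nontriv mod_ring list \<Rightarrow> 'n mod_ring set \<Rightarrow> 'n mod_ring set option" where
  "run [] X = Some X"
| "run (i # w) X = Option.bind (run w X) (hop i)"

lemma hop_eq_Some_iff:
  "hop i X = Some Y \<longleftrightarrow> i \<in> X \<and> i + 1 \<notin> X \<and> Y = insert (i + 1) (X - {i})"
  by (auto simp: hop_def)

lemma run_append: "run (u @ v) X = Option.bind (run v X) (run u)"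
  by (induction u) (cases "run v X"; simp)+

lemma run_Cons_eq_Some_iff:
  "run (i # w) X = Some Y \<longleftrightarrow>
     (\<exists>Z. run w X = Some Z \<and> i \<in> Z \<and> i + 1 \<notin> Z \<and> Y = insert (i + 1) (Z - {i}))"
  by (auto simp: bind_eq_Some_conv hop_eq_Some_iff)

lemma run_append_eq_Some_iff:
  "run (u @ v) X = Some Y \<longleftrightarrow> (\<exists>Z. run v X = Some Z \<and> run u Z = Some Y)"
  by (auto simp: run_append bind_eq_Some_conv)

text \<open>
  Conservation of particles at site \<open>i\<close>: letter \<open>i\<close> is the only way out and letter \<open>i - 1\<close> the only
  way in.
\<close>

lemma run_count:
  assumes "run w X = Some Y"
  shows "count_list w i + of_bool (i \<in> Y) = count_list w (i - 1) + of_bool (i \<in> X)"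
  using assms
proof (induction w arbitrary: Y)
  case (Cons j w)
  then obtain Z where "run w X = Some Z" "j \<in> Z" "j + 1 \<notin> Z" "Y = insert (j + 1) (Z - {j})"
    unfolding run_Cons_eq_Some_iff by blast
  with Cons.IH[of Z] show ?case
    by (auto simp: algebra_simps split: if_splits)
qed simp

lemma run_card:
  assumes "run w X = Some Y"
  shows "card Y = card X"
  using assms
proof (induction w arbitrary: Y)
  case (Cons j w)
  then obtain Z where "run w X = Some Z" "j \<in> Z" "j + 1 \<notin> Z" "Y = insert (j + 1) (Z - {j})"
    unfolding run_Cons_eq_Some_iff by blast
  moreover from this have "card Z > 0"
    by (auto simp: card_gt_0_iff)
  ultimately show ?case
    using Cons.IH[of Z] by simp
qed simp

lemma run_commute:
  assumes "\<And>j. j \<in> set v \<Longrightarrow> j \<noteq> i + 1 \<and> j \<noteq> i - 1"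
  shows "run (i # v) X = run (v @ [i]) X"
  using assms
proof (induction v)
  case (Cons j v)
  have "Option.bind (hop j Z) (hop i) = Option.bind (hop i Z) (hop j)" for Z
    using Cons.prems[of j] by (auto simp: hop_def algebra_simps)
  then have "run (i # j # v) X = Option.bind (run (i # v) X) (hop j)"
    by (simp add: bind_assoc)
  also have "run (i # v) X = run (v @ [i]) X"
    using Cons by simp
  finally show ?case by simp
qed simp

text \<open>
  As long as the particle at \<open>i\<close> has not used its free way to \<open>i + 1\<close>, no other particle can enter
  \<open>i\<close>, and nobody can leave \<open>i + 1\<close>. Hence a legal first move commutes with everything that another
  execution does before making that move.
\<close>

lemma run_blocked:
  assumes "run v X = Some Z" "i \<in> X" "i + 1 \<notin> X" "i \<notin> set v"
  shows "i + 1 \<notin> set v \<and> i - 1 \<notin> set v \<and> i \<in> Z \<and> i + 1 \<notin> Z"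
  using assms
proof (induction v arbitrary: Z)
  case (Cons j v)
  then obtain Z' where Z': "run v X = Some Z'" "j \<in> Z'" "j + 1 \<notin> Z'" "Z = insert (j + 1) (Z' - {j})"
    unfolding run_Cons_eq_Some_iff by blast
  with Cons.IH[of Z'] Cons.prems have "i + 1 \<notin> set v \<and> i - 1 \<notin> set v \<and> i \<in> Z' \<and> i + 1 \<notin> Z'"
    by simp
  with Z' Cons.prems show ?case by auto
qed auto

text \<open>
  The letter of \<open>w\<close> that is executed first among \<open>i\<close> (departure, so \<open>i\<close> is occupied at the start) and \<open>i - 1\<close> (arrival,
  so \<open>i\<close> is free at the start) determines the initial state of site \<open>i\<close>.
\<close>

lemma run_sites_agree:
  assumes "run w X = Some Y" "run w X' = Some Y'" "i \<in> set w \<or> i - 1 \<in> set w"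
  shows "i \<in> X \<longleftrightarrow> i \<in> X'"
  using assms
proof (induction w arbitrary: X X' rule: rev_induct)
  case (snoc j w)
  from snoc.prems obtain Z Z' where
    Z: "run w Z = Some Y" "j \<in> X" "j + 1 \<notin> X" "Z = insert (j + 1) (X - {j})" and
    Z': "run w Z' = Some Y'" "j \<in> X'" "j + 1 \<notin> X'" "Z' = insert (j + 1) (X' - {j})"
    unfolding run_append_eq_Some_iff run_Cons_eq_Some_iff by auto
  show ?case
  proof (cases "i = j \<or> i = j + 1")
    case False
    then have "i \<in> set w \<or> i - 1 \<in> set w"
      using snoc.prems by auto
    then have "i \<in> Z \<longleftrightarrow> i \<in> Z'"
      using snoc.IH Z(1) Z'(1) by blast
    then show ?thesis using False Z Z' by auto
  qed (use Z Z' in auto)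
qed simp

text \<open>
  An empty site that was ever touched has been left after the last arrival. The next lemma is the
  mirror image for an occupied site.
\<close>

lemma run_last_departure:
  assumes "run w X = Some Y" "j \<notin> Y" "j \<in> set w \<or> j - 1 \<in> set w"
  shows "\<exists>u v. w = u @ j # v \<and> j \<notin> set u \<and> j - 1 \<notin> set u"
  using assms
proof (induction w arbitrary: Y)
  case (Cons i w)
  then obtain Z where Z: "run w X = Some Z" "i \<in> Z" "i + 1 \<notin> Z" "Y = insert (i + 1) (Z - {i})"
    unfolding run_Cons_eq_Some_iff by blast
  show ?case
  proof (cases "i = j")
    case True
    then show ?thesis by (intro exI[of _ "[]"] exI[of _ w]) auto
  next
    case False
    with Z Cons.prems have "j - 1 \<noteq> i" "j \<notin> Z" by auto
    with Cons.prems False Cons.IH[OF Z(1)] obtain u v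
      where "w = u @ j # v" "j \<notin> set u" "j - 1 \<notin> set u" by auto
    then show ?thesis using False \<open>j - 1 \<noteq> i\<close> by (intro exI[of _ "i # u"] exI[of _ v]) auto
  qed
qed simp

lemma run_last_arrival:
  assumes "run w X = Some Y" "j \<in> Y" "j \<in> set w \<or> j - 1 \<in> set w"
  shows "\<exists>u v. w = u @ (j - 1) # v \<and> j \<notin> set u \<and> j - 1 \<notin> set u"
  using assms
proof (induction w arbitrary: Y)
  case (Cons i w)
  then obtain Z where Z: "run w X = Some Z" "i \<in> Z" "i + 1 \<notin> Z" "Y = insert (i + 1) (Z - {i})"
    unfolding run_Cons_eq_Some_iff by blast
  show ?case
  proof (cases "i = j - 1")
    case True
    then show ?thesis by (intro exI[of _ "[]"] exI[of _ w]) auto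
  next
    case False
    with Z Cons.prems have "j \<noteq> i" "j \<in> Z" by auto
    with Cons.prems False Cons.IH[OF Z(1)] obtain u v
      where "w = u @ (j - 1) # v" "j \<notin> set u" "j - 1 \<notin> set u" by auto
    then show ?thesis using False \<open>j \<noteq> i\<close> by (intro exI[of _ "i # u"] exI[of _ v]) auto
  qed
qed simp

lemma run_insert:
  assumes "run w X = Some Y" "i \<notin> set w" "i - 1 \<notin> set w"
  shows "run w (insert i X) = Some (insert i Y)"
  using assms
proof (induction w arbitrary: Y)
  case (Cons j w)
  then obtain Z where Z: "run w X = Some Z" "j \<in> Z" "j + 1 \<notin> Z" "Y = insert (j + 1) (Z - {j})"
    unfolding run_Cons_eq_Some_iff by blast
  moreover have "run w (insert i X) = Some (insert i Z)"
    using Cons Z by simp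
  ultimately show ?case
    using Cons.prems by (auto simp: hop_def)
qed simp

lemma run_proper_nonempty:
  assumes "run w X = Some Y" "w \<noteq> []"
  shows "X \<noteq> {} \<and> X \<noteq> UNIV"
proof -
  from assms obtain w' j where "w = w' @ [j]" by (metis rev_exhaust)
  with assms show ?thesis
    by (auto simp: run_append_eq_Some_iff hop_def)
qed


section \<open>Vanishing and coincidence of monomials\<close>

lemma abs_nTL_eq_iff: "abs_nTL x = abs_nTL y \<longleftrightarrow> x - y \<in> nTL_ideal"
  using nTL.abs_eq_iff[of x y] by (simp add: nTL_rel_def)

lemma nTL_rels_imp_abs_eq_0:
  assumes "r \<in> nTL_rels"
  shows "abs_nTL r = 0"
  using nTL_ideal.rel[OF assms, of 1 1] abs_nTL_eq_iff[of r 0]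
  by (simp add: zero_nTL_def)

lemma nTL_gen_square: "nTL_gen i * nTL_gen i = 0"
proof -
  have "free_gen i * free_gen i \<in> nTL_rels"
    unfolding nTL_rels_def by blast
  from nTL_rels_imp_abs_eq_0[OF this] show ?thesis
    by (simp add: nTL_gen_def times_nTL.abs_eq)
qed

lemma nTL_gen_commute:
  assumes "i - j \<noteq> 1" "i - j \<noteq> -1"
  shows "nTL_gen i * nTL_gen j = nTL_gen j * nTL_gen i"
proof -
  have "free_gen i * free_gen j - free_gen j * free_gen i \<in> nTL_rels"
    unfolding nTL_rels_def using assms by blast
  from nTL_rels_imp_abs_eq_0[OF this] show ?thesis
    by (simp add: nTL_gen_def times_nTL.abs_eq flip: minus_nTL.abs_eq)
qed

lemma nTL_gen_braid_up: "nTL_gen i * nTL_gen (i + 1) * nTL_gen i = 0"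
proof -
  have "free_gen i * free_gen (i + 1) * free_gen i \<in> nTL_rels"
    unfolding nTL_rels_def by blast
  from nTL_rels_imp_abs_eq_0[OF this] show ?thesis
    by (simp add: nTL_gen_def times_nTL.abs_eq)
qed

lemma nTL_gen_braid_down: "nTL_gen i * nTL_gen (i - 1) * nTL_gen i = 0"
proof -
  have "free_gen (i - 1 + 1) * free_gen (i - 1) * free_gen (i - 1 + 1) \<in> nTL_rels"
    unfolding nTL_rels_def by blast
  from nTL_rels_imp_abs_eq_0[OF this] show ?thesis
    by (simp add: nTL_gen_def times_nTL.abs_eq)
qed

lemma nTL_monom_Nil [simp]: "nTL_monom [] = 1"
  by (simp add: nTL_monom_def)

lemma nTL_monom_Cons [simp]: "nTL_monom (i # w) = nTL_gen i * nTL_monom w"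
  by (simp add: nTL_monom_def)

lemma nTL_monom_append [simp]: "nTL_monom (u @ v) = nTL_monom u * nTL_monom v"
  by (simp add: nTL_monom_def)

lemma nTL_monom_commute:
  assumes "\<And>j. j \<in> set v \<Longrightarrow> j \<noteq> i + 1 \<and> j \<noteq> i - 1"
  shows "nTL_gen i * nTL_monom v = nTL_monom v * (nTL_gen i :: ('k::field, 'n::nontriv) nTL)"
  using assms
proof (induction v)
  case (Cons j v)
  have "nTL_gen i * nTL_gen j = nTL_gen j * (nTL_gen i :: ('k, 'n) nTL)"
    using Cons.prems[of j] by (intro nTL_gen_commute) (auto simp: algebra_simps)
  then have "nTL_gen i * nTL_monom (j # v) = nTL_gen j * (nTL_gen i * nTL_monom v :: ('k, 'n) nTL)"
    by (simp flip: mult.assoc)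
  then show ?case using Cons by (simp add: mult.assoc)
qed simp

text \<open>
  If at most one letter adjacent to \<open>i\<close> occurs between two copies of \<open>i\<close>, the copies can be moved
  together: next to each other, or around that single neighbour. Both products vanish by the
  relations.
\<close>

lemma nTL_monom_sandwich_eq_0:
  fixes i c :: "'n::nontriv mod_ring"
  assumes "i \<notin> set u" "c = i + 1 \<or> c = i - 1" "count_list u c \<le> 1"
    and other: "\<And>d. d \<noteq> c \<Longrightarrow> d = i + 1 \<or> d = i - 1 \<Longrightarrow> d \<notin> set u"
  shows "nTL_monom (i # u @ [i]) = (0 :: ('k::field, 'n) nTL)"
proof (cases "c \<in> set u")
  case False
  then have "nTL_gen i * nTL_monom u = nTL_monom u * (nTL_gen i :: ('k, 'n) nTL)"
    using other by (intro nTL_monom_commute) metis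
  then have "nTL_monom (i # u @ [i]) = nTL_monom u * (nTL_gen i * nTL_gen i :: ('k, 'n) nTL)"
    by (simp add: mult.assoc flip: mult.assoc[of "nTL_gen i"])
  then show ?thesis by (simp add: nTL_gen_square)
next
  case True
  then obtain p q where u: "u = p @ c # q" by (meson split_list)
  with assms(3) have c: "c \<notin> set p" "c \<notin> set q"
    by (auto simp: count_list_0_iff)
  have pq: "j \<noteq> i + 1 \<and> j \<noteq> i - 1" if "j \<in> set p \<union> set q" for j
    using that c other[of j] u by auto
  have p: "nTL_gen i * nTL_monom p = nTL_monom p * (nTL_gen i :: ('k, 'n) nTL)"
    using pq by (intro nTL_monom_commute) auto
  have q: "nTL_gen i * nTL_monom q = nTL_monom q * (nTL_gen i :: ('k, 'n) nTL)"
    using pq by (intro nTL_monom_commute) auto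
  have "nTL_monom (i # u @ [i]) = nTL_gen i * nTL_monom p * (nTL_gen c * (nTL_monom q * nTL_gen i) :: ('k, 'n) nTL)"
    by (simp add: u mult.assoc)
  also have "\<dots> = nTL_monom p * (nTL_gen i * nTL_gen c * nTL_gen i) * nTL_monom q"
    by (simp add: p flip: q) (simp add: mult.assoc)
  also have "nTL_gen i * nTL_gen c * nTL_gen i = (0 :: ('k, 'n) nTL)"
    using assms(2) nTL_gen_braid_up nTL_gen_braid_down by blast
  finally show ?thesis by simp
qed

text \<open>
  Induction on the number of moves. The first move \<open>i\<close> of the first word also occurs in the second
  one, and by \<open>run_blocked\<close> its first occurrence there commutes past all earlier moves. Deleting
  it from both words leaves two words that are executable from the configuration after this move.
\<close>

lemma nTL_monom_eq_if_mset_eq: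
  assumes "run w X = Some Y" "run w' X = Some Y'" "mset w = mset w'"
  shows "nTL_monom w = (nTL_monom w' :: ('k::field, 'n::nontriv) nTL)"
  using assms
proof (induction w arbitrary: w' X rule: rev_induct)
  case (snoc i w)
  from snoc.prems(1) obtain X1 where
    X1: "hop i X = Some X1" "run w X1 = Some Y" and iX: "i \<in> X" "i + 1 \<notin> X"
    by (auto simp: run_append_eq_Some_iff hop_eq_Some_iff)
  have "i \<in> set w'"
    using snoc.prems(3) by (metis mset_eq_setD in_set_conv_decomp)
  then obtain u v where w': "w' = u @ i # v" and iv: "i \<notin> set v"
    by (meson split_list_last)
  obtain Z where Z: "run v X = Some Z"
    using snoc.prems(2) unfolding w' run_append_eq_Some_iff run_Cons_eq_Some_iff by blast
  have v: "\<And>j. j \<in> set v \<Longrightarrow> j \<noteq> i + 1 \<and> j \<noteq> i - 1"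
    using run_blocked[OF Z iX iv] by auto
  have "run (u @ (i # v)) X = run (u @ (v @ [i])) X"
    by (simp only: run_append[of u] run_commute[OF v])
  then have "run (u @ v @ [i]) X = Some Y'"
    using snoc.prems(2) unfolding w' by simp
  then have "run (u @ v) X1 = Some Y'"
    using X1 by (simp add: run_append)
  then have "nTL_monom w = (nTL_monom (u @ v) :: ('k, 'n) nTL)"
    using snoc.prems(3) w' by (intro snoc.IH[OF X1(2)]) auto
  then show ?case
    using nTL_monom_commute[OF v, where 'k='k] by (simp add: w' mult.assoc)
qed (use assms in simp)


section \<open>Nonzero monomials and their types\<close>

text \<open>
  The inclusion \<open>X \<subseteq> set w\<close> says that \<open>X\<close> is the smallest starting configuration, and it is what
  makes the induction work: an occupied site at the end of \<open>w\<close> has then been reached by a move, and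
  is not occupied by a particle that was idle all along. A new letter \<open>i\<close> on the left can fail for two
  reasons. If \<open>i + 1\<close> is occupied, the particle there arrived through an earlier \<open>i\<close>, and since then
  neither \<open>i\<close> nor \<open>i + 1\<close> was used, and \<open>i - 1\<close> at most once. If \<open>i\<close> is empty but was touched, its particle left
  through an earlier \<open>i\<close>, and since then neither \<open>i - 1\<close> nor \<open>i\<close> was used, and \<open>i + 1\<close> at most once. In both cases the
  monomial vanishes by \<open>nTL_monom_sandwich_eq_0\<close>. If \<open>i\<close> is empty and was never touched, a particle
  can be added at \<open>i\<close> from the beginning.
\<close>

lemma nTL_monom_nonzero_imp_run:
  assumes "nTL_monom w \<noteq> (0 :: ('k::field, 'n::nontriv) nTL)"
  shows "\<exists>X Y. run w X = Some Y \<and> X \<subseteq> set w"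
  using assms
proof (induction w)
  case (Cons i w)
  let ?m = "nTL_monom :: 'n mod_ring list \<Rightarrow> ('k, 'n) nTL"
  from Cons.prems have "?m w \<noteq> 0"
    by auto
  with Cons.IH obtain X Y where XY: "run w X = Some Y" "X \<subseteq> set w"
    by blast
  have i1: "i + 1 \<in> set w \<or> i \<in> set w" if "i + 1 \<in> Y"
    using run_count[OF XY(1), of "i + 1"] that XY(2) by (auto simp: of_bool_def split: if_splits)
  have not_zero: "?m (i # u @ [i]) \<noteq> 0" if "w = u @ i # v" for u v
    using Cons.prems unfolding that
    by (metis append_Cons append_Nil append_assoc mult_zero_left nTL_monom_append)
  consider "i \<in> Y" "i + 1 \<notin> Y" | "i \<in> Y" "i + 1 \<in> Y" | "i \<notin> Y" by blast
  then show ?case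
  proof cases
    case 1
    then show ?thesis using XY by (intro exI[of _ X] exI[of _ "insert (i + 1) (Y - {i})"]) (auto simp: hop_def)
  next
    case 2
    with i1 run_last_arrival[OF XY(1), of "i + 1"] obtain u v where
      w: "w = u @ i # v" and u: "i + 1 \<notin> set u" "i \<notin> set u"
      by auto
    from XY(1) obtain Z where "run u Z = Some Y"
      unfolding w run_append_eq_Some_iff by blast
    from run_count[OF this, of i] have "count_list u (i - 1) \<le> 1"
      using u 2 by auto
    then have "?m (i # u @ [i]) = 0"
      using u by (intro nTL_monom_sandwich_eq_0[where c = "i - 1"]) auto
    with not_zero w show ?thesis by blast
  next
    case 3
    show ?thesis
    proof (cases "i \<in> set w \<or> i - 1 \<in> set w")
      case True
      with 3 run_last_departure[OF XY(1), of i] obtain u v where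
        w: "w = u @ i # v" and u: "i \<notin> set u" "i - 1 \<notin> set u"
        by auto
      from XY(1) obtain Z where "run u Z = Some Y"
        unfolding w run_append_eq_Some_iff by blast
      from run_count[OF this, of "i + 1"] have "count_list u (i + 1) \<le> 1"
        using u by (auto simp: of_bool_def split: if_splits)
      then have "?m (i # u @ [i]) = 0"
        using u by (intro nTL_monom_sandwich_eq_0[where c = "i + 1"]) auto
      with not_zero w show ?thesis by blast
    next
      case False
      have "i + 1 \<notin> Y"
        using run_count[OF XY(1), of "i + 1"] i1 False
        by (auto simp: count_list_0_iff of_bool_def split: if_splits)
      then show ?thesis
        using run_insert[OF XY(1)] False XY(2)
        by (intro exI[of _ "insert i X"] exI[of _ "insert (i + 1) (insert i Y - {i})"])
          (auto simp: hop_def)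
    qed
  qed
qed simp

definition has_type ::
  "'n::nontriv mod_ring set \<Rightarrow> 'n mod_ring set \<Rightarrow> nat \<Rightarrow> 'n mod_ring list \<Rightarrow> bool" where
  "has_type X Y r w \<longleftrightarrow> run w X = Some Y \<and> count_list w 0 = r \<and> X \<subseteq> set w"

lemma has_type_Nil_iff: "has_type {} Y r w \<longleftrightarrow> w = [] \<and> Y = {} \<and> r = 0"
  using run_proper_nonempty[of w "{}" Y] by (cases "w = []") (auto simp: has_type_def)

lemma has_type_inject:
  assumes "has_type X Y r w" "has_type X' Y' r' w"
  shows "X = X' \<and> Y = Y' \<and> r = r'"
proof -
  have "X = X'"
    using assms run_sites_agree[of w X Y X' Y'] unfolding has_type_def by blast
  with assms show ?thesis by (simp add: has_type_def)
qed

text \<open>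
  By \<open>run_count\<close>, the differences between the multiplicities of neighbouring letters depend only on
  \<open>X\<close> and \<open>Y\<close>; so the multiplicity of the letter \<open>0\<close> fixes all of them.
\<close>

lemma run_monom_determined:
  fixes w w' :: "'n::nontriv mod_ring list"
  assumes run: "run w X = Some Y" "run w' X = Some Y" and "count_list w 0 = count_list w' 0"
  shows "nTL_monom w = (nTL_monom w' :: ('k::field, 'n) nTL)"
proof -
  have "count_list w (of_nat n) = count_list w' (of_nat n)" for n
  proof (induction n)
    case (Suc n)
    then show ?case
      using run_count[OF run(1), of "of_nat (Suc n)"] run_count[OF run(2), of "of_nat (Suc n)"]
      by simp
  qed (use assms in simp)
  then have "count_list w i = count_list w' i" for i
    using mod_ring_eq_of_nat[of i] by metis
  then have "mset w = mset w'"
    by (simp add: multiset_eq_iff count_mset)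
  with run show ?thesis by (rule nTL_monom_eq_if_mset_eq)
qed


section \<open>Linear functionals that detect the type of a monomial\<close>

text \<open>
  The words in the monomial relations are not executable from any configuration. The cubic ones need
  \<open>N \<ge> 3\<close>: on a circle with two sites, the letters \<open>i, i + 1, i\<close> would move a single particle around.
\<close>

lemma run_square_eq_None: "run [i, i] X = None"
  by (auto simp: hop_def)

lemma run_braid_up_eq_None:
  "CARD('n::nontriv) \<ge> 3 \<Longrightarrow> run [i, i + 1, i :: 'n mod_ring] X = None"
  using mod_ring_two_neq_0[where 'n='n] by (auto simp: hop_def add.assoc)

lemma run_braid_down_eq_None:
  "CARD('n::nontriv) \<ge> 3 \<Longrightarrow> run [i + 1, i, i + 1 :: 'n mod_ring] X = None"
  using mod_ring_two_neq_0[where 'n='n] by (auto simp: hop_def add.assoc)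

lemma has_type_embedded_None:
  assumes "\<And>X. run s X = None"
  shows "\<not> has_type X Y r (u @ s @ v)"
  using assms by (auto simp: has_type_def run_append_eq_Some_iff)

lemma has_type_commute:
  assumes "i - j \<noteq> 1" "i - j \<noteq> -1"
  shows "has_type X Y r (u @ [i, j] @ v) \<longleftrightarrow> has_type X Y r (u @ [j, i] @ v)"
proof -
  have "run [i, j] Z = run [j, i] Z" for Z
    using run_commute[where v = "[j]" and i = i and X = Z] assms
    by (auto simp: algebra_simps)
  then have "run ([i, j] @ v) X = run ([j, i] @ v) X"
    unfolding run_append[of _ v] by presburger
  then have "run (u @ [i, j] @ v) X = run (u @ [j, i] @ v) X"
    by (simp only: run_append[of u])
  then show ?thesis by (auto simp: has_type_def)
qed

definition type_coeff ::
  "'n::nontriv mod_ring set \<Rightarrow> 'n mod_ring set \<Rightarrow> nat \<Rightarrow> ('n mod_ring fword \<Rightarrow>\<^sub>0 'k::field) \<Rightarrow> 'k" where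
  "type_coeff X Y r x =
     (\<Sum>w | w \<in> Poly_Mapping.keys x \<and> has_type X Y r (letters w). Poly_Mapping.lookup x w)"

lemma type_coeff_eq_sum_superset:
  assumes "finite S" "Poly_Mapping.keys x \<subseteq> S"
  shows "type_coeff X Y r x = (\<Sum>w | w \<in> S \<and> has_type X Y r (letters w). Poly_Mapping.lookup x w)"
  unfolding type_coeff_def using assms
  by (intro sum.mono_neutral_left) (auto simp: in_keys_iff)

lemma type_coeff_add: "type_coeff X Y r (x + y) = type_coeff X Y r x + type_coeff X Y r y"
proof -
  let ?S = "Poly_Mapping.keys x \<union> Poly_Mapping.keys y"
  have "finite ?S" "Poly_Mapping.keys (x + y) \<subseteq> ?S"
    using Poly_Mapping.keys_add[of x y] by auto
  then show ?thesis
    by (simp add: type_coeff_eq_sum_superset[of ?S] lookup_add sum.distrib)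
qed

lemma type_coeff_0 [simp]: "type_coeff X Y r 0 = 0"
  by (simp add: type_coeff_def)

lemma type_coeff_diff: "type_coeff X Y r (x - y) = type_coeff X Y r x - type_coeff X Y r y"
  using type_coeff_add[of X Y r "x - y" y] by simp

lemma type_coeff_single:
  "type_coeff X Y r (Poly_Mapping.single w c) = (if has_type X Y r (letters w) then c else 0)"
proof -
  have "{w'. w' \<in> {w} \<and> has_type X Y r (letters w')} = (if has_type X Y r (letters w) then {w} else {})"
    by auto
  then show ?thesis
    by (subst type_coeff_eq_sum_superset[of "{w}"]) auto
qed

lemma poly_mapping_additive_induct [case_names zero single add]:
  assumes "P 0" "\<And>w c. P (Poly_Mapping.single w c)" "\<And>x y. P x \<Longrightarrow> P y \<Longrightarrow> P (x + y)"
  shows "P (x :: 'a \<Rightarrow>\<^sub>0 'b::comm_monoid_add)"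
proof (induction x rule: update_induct)
  case const
  then show ?case using assms(1) by simp
next
  case (update f k v)
  have "Poly_Mapping.update k v f = Poly_Mapping.single k v + f"
    using update(1) by (intro poly_mapping_eqI)
      (auto simp: lookup_update lookup_add lookup_single when_def in_keys_iff)
  with update assms show ?case by metis
qed

lemma letters_plus [simp]: "letters (u + v) = letters u @ letters v"
  by (simp add: plus_fword_def)

lemma type_coeff_rel:
  fixes r :: "'n::nontriv mod_ring fword \<Rightarrow>\<^sub>0 'k::field"
  assumes N: "CARD('n) \<ge> 3" and "r \<in> nTL_rels"
  shows "type_coeff X Y m (Poly_Mapping.single u c * r * Poly_Mapping.single v d) = 0"
proof -
  have single: "type_coeff X Y m (Poly_Mapping.single u c * Poly_Mapping.single (FWord s) 1
      * Poly_Mapping.single v d) = (if has_type X Y m (letters u @ s @ letters v) then c * d else 0)" for s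
    by (simp add: mult_single type_coeff_single)
  have zero: "type_coeff X Y m (Poly_Mapping.single u c * Poly_Mapping.single (FWord s) 1
      * Poly_Mapping.single v d) = 0" if "\<And>X. run s X = None" for s
    using has_type_embedded_None[OF that] by (simp add: single)
  have words: "free_gen i * free_gen j = Poly_Mapping.single (FWord [i, j]) (1 :: 'k)"
    "free_gen i * free_gen j * free_gen l = Poly_Mapping.single (FWord [i, j, l]) (1 :: 'k)"
    for i j l :: "'n mod_ring"
    by (simp_all add: free_gen_def mult_single plus_fword_def)
  from assms(2) consider
    i where "r = free_gen i * free_gen i"
    | i j where "r = free_gen i * free_gen j - free_gen j * free_gen i" "i - j \<noteq> 1" "i - j \<noteq> - 1"
    | i where "r = free_gen i * free_gen (i + 1) * free_gen i"
    | i where "r = free_gen (i + 1) * free_gen i * free_gen (i + 1)"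
    unfolding nTL_rels_def by blast
  then show ?thesis
  proof cases
    case (2 i j)
    then show ?thesis
      using has_type_commute[OF 2(2,3), of X Y m "letters u" "letters v"]
      by (simp add: words left_diff_distrib right_diff_distrib type_coeff_diff single)
  qed (simp_all only: words(2) zero[OF run_braid_up_eq_None[OF N]]
      zero[OF run_braid_down_eq_None[OF N]], simp_all only: words(1) zero[OF run_square_eq_None])
qed

text \<open>
  A two-sided ideal is spanned by the products \<open>u r v\<close> with words \<open>u\<close>, \<open>v\<close> and defining relations \<open>r\<close>;
  the two inductions reduce to these.
\<close>

lemma type_coeff_ideal:
  fixes x :: "'n::nontriv mod_ring fword \<Rightarrow>\<^sub>0 'k::field"
  assumes N: "CARD('n) \<ge> 3" and "x \<in> nTL_ideal"
  shows "type_coeff X Y m x = 0"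
  using assms(2)
proof (induction rule: nTL_ideal.induct)
  case (rel r x y)
  show ?case
  proof (induction x rule: poly_mapping_additive_induct)
    case (single u c)
    show ?case
      by (induction y rule: poly_mapping_additive_induct)
        (simp_all add: type_coeff_rel[OF N rel] distrib_left type_coeff_add)
  qed (simp_all add: distrib_right type_coeff_add)
qed (simp_all add: type_coeff_add)

text \<open>
  The functional \<open>type_coeff\<close> descends to the quotient only for \<open>N \<ge> 3\<close>, a condition on the type
  \<open>'n\<close>. So it is evaluated on a chosen representative, and well-definedness is the lemma
  \<open>nTL_type_coeff_abs\<close>.
\<close>

definition nTL_type_coeff ::
  "'n::nontriv mod_ring set \<Rightarrow> 'n mod_ring set \<Rightarrow> nat \<Rightarrow> ('k::field, 'n) nTL \<Rightarrow> 'k" where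
  "nTL_type_coeff X Y r z = type_coeff X Y r (rep_nTL z)"

lemma abs_rep_nTL: "abs_nTL (rep_nTL z) = z"
  by (rule Quotient3_abs_rep[OF Quotient3_nTL])

lemma nTL_type_coeff_abs:
  fixes x :: "'n::nontriv mod_ring fword \<Rightarrow>\<^sub>0 'k::field"
  assumes "CARD('n) \<ge> 3"
  shows "nTL_type_coeff X Y r (abs_nTL x) = type_coeff X Y r x"
proof -
  have "rep_nTL (abs_nTL x) - x \<in> nTL_ideal"
    by (simp add: abs_rep_nTL flip: abs_nTL_eq_iff)
  from type_coeff_ideal[OF assms this, of X Y r] show ?thesis
    by (simp add: nTL_type_coeff_def type_coeff_diff)
qed

lemma nTL_monom_eq_abs: "nTL_monom w = abs_nTL (Poly_Mapping.single (FWord w) 1)"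
proof (induction w)
  case (Cons i w)
  then show ?case
    by (simp add: nTL_gen_def free_gen_def times_nTL.abs_eq mult_single plus_fword_def)
qed (simp add: one_nTL_def flip: zero_fword_def)

lemma abs_nTL_single: "abs_nTL (Poly_Mapping.single w c) = nTL_scale c (nTL_monom (letters w))"
  by (simp add: nTL_monom_eq_abs nTL_scale.abs_eq mult_single)

lemma nTL_monoms_span: "nTL.span (range nTL_monom) = (UNIV :: ('k::field, 'n::nontriv) nTL set)"
proof -
  have "abs_nTL x \<in> nTL.span (range nTL_monom)" for x :: "'n mod_ring fword \<Rightarrow>\<^sub>0 'k"
  proof (induction x rule: poly_mapping_additive_induct)
    case zero
    then show ?case by (simp add: nTL.span_zero flip: zero_nTL_def)
  next
    case (single w c)
    then show ?case by (auto simp: abs_nTL_single intro: nTL.span_scale nTL.span_base)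
  next
    case (add x y)
    then show ?case by (simp add: nTL.span_add flip: plus_nTL.abs_eq)
  qed
  then show ?thesis by (metis UNIV_eq_I abs_rep_nTL)
qed

lemma nTL_type_coeff_add:
  assumes "CARD('n::nontriv) \<ge> 3"
  shows "nTL_type_coeff X Y r (x + y :: ('k::field, 'n) nTL) = nTL_type_coeff X Y r x + nTL_type_coeff X Y r y"
proof -
  have "nTL_type_coeff X Y r (abs_nTL (rep_nTL x) + abs_nTL (rep_nTL y)) = 
    nTL_type_coeff X Y r (abs_nTL (rep_nTL x)) + nTL_type_coeff X Y r (abs_nTL (rep_nTL y))"
    by (simp only: plus_nTL.abs_eq nTL_type_coeff_abs[OF assms] type_coeff_add)
  then show ?thesis by (simp only: abs_rep_nTL)
qed

lemma nTL_type_coeff_scale: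
  assumes "CARD('n::nontriv) \<ge> 3"
  shows "nTL_type_coeff X Y r (nTL_scale c (x :: ('k::field, 'n) nTL)) = c * nTL_type_coeff X Y r x"
proof -
  have "type_coeff X Y r (Poly_Mapping.single 0 c * y) = c * type_coeff X Y r y" for y :: "'n mod_ring fword \<Rightarrow>\<^sub>0 'k"
    by (induction y rule: poly_mapping_additive_induct)
      (simp_all add: distrib_left type_coeff_add mult_single type_coeff_single)
  then have "nTL_type_coeff X Y r (nTL_scale c (abs_nTL (rep_nTL x))) = c * nTL_type_coeff X Y r (abs_nTL (rep_nTL x))"
    by (simp only: nTL_scale.abs_eq nTL_type_coeff_abs[OF assms])
  then show ?thesis by (simp only: abs_rep_nTL)
qed

lemma nTL_type_coeff_monom:
  assumes "CARD('n::nontriv) \<ge> 3"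
  shows "nTL_type_coeff X Y r (nTL_monom w :: ('k::field, 'n) nTL) = of_bool (has_type X Y r w)"
  by (simp add: nTL_monom_eq_abs nTL_type_coeff_abs[OF assms] type_coeff_single)

lemma nTL_scale_minus_one_power: "nTL_scale ((- 1) ^ m) x = (- 1) ^ m * x"
  by (cases "even m") simp_all

text \<open>
  Each element of \<open>B\<close> is, up to sign, a monomial with a type, and different elements have different
  types. So the functional of the type of \<open>b\<close> vanishes on all other elements of \<open>B\<close> but not on \<open>b\<close>.
  The predicate \<open>P\<close> stands for a description of the type of \<open>b\<close> from which \<open>b\<close> can be recovered.
\<close>

lemma nTL_independent_if_distinct_types:
  fixes B :: "('k::field, 'n::nontriv) nTL set"
  assumes N: "CARD('n) \<ge> 3"
    and typed: "\<And>b. b \<in> B \<Longrightarrow> \<exists>X Y r m w. P b X Y r \<and> has_type X Y r w \<and> b = (- 1) ^ m * nTL_monom w"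
    and inj: "\<And>b b' X Y r. b \<in> B \<Longrightarrow> b' \<in> B \<Longrightarrow> P b X Y r \<Longrightarrow> P b' X Y r \<Longrightarrow> b = b'"
  shows "nTL.independent B"
  unfolding nTL.dependent_def
proof safe
  fix b assume b: "b \<in> B" "b \<in> nTL.span (B - {b})"
  obtain X Y r m w where bt: "P b X Y r" "has_type X Y r w" "b = (- 1) ^ m * nTL_monom w"
    using typed[OF b(1)] by blast
  let ?f = "nTL_type_coeff X Y r :: ('k, 'n) nTL \<Rightarrow> 'k"
  have signed: "?f ((- 1) ^ m * nTL_monom w) = (- 1) ^ m * of_bool (has_type X Y r w)" for m w
    by (simp add: nTL_type_coeff_scale[OF N] nTL_type_coeff_monom[OF N]
        flip: nTL_scale_minus_one_power)
  have "?f b = 0"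
    using b(2)
  proof (induction rule: nTL.span_induct)
    case base
    show ?case
    proof (rule nTL.subspaceI)
      show "0 \<in> {x. ?f x = 0}"
        using nTL_type_coeff_scale[OF N, of X Y r 0 0] by simp
    qed (simp_all add: nTL_type_coeff_add[OF N] nTL_type_coeff_scale[OF N])
  next
    case (step b')
    then obtain X' Y' r' m' w' where
      b': "P b' X' Y' r'" "has_type X' Y' r' w'" "b' = (- 1) ^ m' * nTL_monom w'"
      using typed[of b'] by blast
    have "\<not> has_type X Y r w'"
      using step inj[of b b'] b(1) bt(1) b'(1,2) has_type_inject by blast
    then show ?case by (simp add: b'(3) signed)
  qed
  then show False using bt by (simp add: signed)
qed


section \<open>The rotation by one particle\<close>

text \<open>
  Suppose that every letter occurs exactly once. Reading the word from right to left, such a word is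
  executable from \<open>X\<close> if each occupied site \<open>z\<close> is vacated before the particle from \<open>z - 1\<close>
  arrives, and each empty site is filled before it is left; in the end every particle of \<open>X\<close> sits
  at the starting site of the next one. The condition only compares the letters of neighbouring
  sites, so it can be checked on the blocks of the word of \<open>a(I)\<close>.
\<close>

lemma run_loop_criterion:
  fixes u :: "'n::nontriv mod_ring list"
  assumes "distinct u" "set u = UNIV"
    and sorted: "sorted_wrt (\<lambda>x z. (z = x + 1 \<longrightarrow> z \<in> X) \<and> (x = z + 1 \<longrightarrow> x \<notin> X)) u"
  shows "run u X = Some X"
proof -
  \<comment> \<open>After the moves \<open>v\<close>, an occupied site is still or again occupied; an empty one has been filled and not yet left.\<close>
  define S where "S v = {j. if j \<in> X then j \<notin> set v \<or> j - 1 \<in> set v else j \<notin> set v \<and> j - 1 \<in> set v}"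
    for v
  have "run v X = Some (S v)" if "u = p @ v" for p v
    using that
  proof (induction v arbitrary: p)
    case Nil
    then show ?case by (auto simp: S_def)
  next
    case (Cons i v)
    have run: "run v X = Some (S v)"
      using Cons.IH[of "p @ [i]"] Cons.prems by simp
    have i: "i \<notin> set p" "i \<notin> set v" and all: "\<And>j. j \<noteq> i \<Longrightarrow> j \<in> set p \<or> j \<in> set v"
      using assms(1,2) unfolding Cons.prems by auto
    have after: "x = i + 1 \<Longrightarrow> x \<in> X" "i = x + 1 \<Longrightarrow> i \<notin> X" if "x \<in> set v" for x
      using sorted that unfolding Cons.prems sorted_wrt_append by auto
    have before: "i = x + 1 \<Longrightarrow> i \<in> X" "x = i + 1 \<Longrightarrow> x \<notin> X" if "x \<in> set p" for x
      using sorted that unfolding Cons.prems sorted_wrt_append by auto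
    \<comment> \<open>The letter \<open>i - 1\<close> has been used iff it had to bring a particle to \<open>i\<close>, and \<open>i + 1\<close> iff it had to vacate that site.\<close>
    have below: "i - 1 \<in> set v \<longleftrightarrow> i \<notin> X"
      using after(2)[of "i - 1"] before(1)[of "i - 1"] all[of "i - 1"] by auto
    have above: "i + 1 \<in> set v \<longleftrightarrow> i + 1 \<in> X"
      using after(1)[of "i + 1"] before(2)[of "i + 1"] all[of "i + 1"] by auto
    have "i \<in> S v" using i below by (auto simp: S_def)
    moreover have "i + 1 \<notin> S v" using i above by (auto simp: S_def)
    moreover have "S (i # v) = insert (i + 1) (S v - {i})"
    proof (rule Set.set_eqI)
      fix j show "j \<in> S (i # v) \<longleftrightarrow> j \<in> insert (i + 1) (S v - {i})"
        using i below above by (cases "j = i"; cases "j = i + 1") (auto simp: S_def algebra_simps)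
    qed
    ultimately show ?case
      using run by (simp add: hop_def)
  qed
  from this[of "[]" u] have "run u X = Some (S u)" by simp
  also have "S u = X" using assms(2) by (auto simp: S_def)
  finally show ?thesis .
qed

lemma pos_enumerates:
  assumes "I \<subseteq> {1..N}" "card I = k" "k \<ge> 1"
  shows "pos N I ` {1..k} = I" "strict_mono_on {1..k} (pos N I)" "pos N I (k + 1) = pos N I 1 + N"
proof -
  let ?xs = "sorted_list_of_set I"
  have fin: "finite I" using assms(1) finite_subset by blast
  have xs: "set ?xs = I" "sorted_wrt (<) ?xs" "length ?xs = k"
    using fin assms by (auto simp: strict_sorted_list_of_set)
  have pos: "pos N I s = ?xs ! (s - 1)" if "s \<in> {1..k}" for s
    using that assms by (auto simp: pos_def)
  have "pos N I ` {1..k} = pos N I ` Suc ` {0..<k}"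
    by (simp add: image_Suc_atLeastLessThan atLeastLessThanSuc_atLeastAtMost)
  also have "\<dots> = (!) ?xs ` {0..<k}"
    unfolding image_image by (intro image_cong) (auto simp: pos)
  also have "\<dots> = set ?xs"
    using nth_image[of k ?xs] xs(3) by simp
  finally show "pos N I ` {1..k} = I" by (simp add: xs)
  show "strict_mono_on {1..k} (pos N I)"
  proof (rule strict_mono_onI)
    fix r s assume "r \<in> {1..k}" "s \<in> {1..k}" "r < s"
    then show "pos N I r < pos N I s"
      using sorted_wrt_nth_less[OF xs(2), of "r - 1" "s - 1"] unfolding xs(3) by (simp add: pos)
  qed
  show "pos N I (k + 1) = pos N I 1 + N"
    using assms by (simp add: pos_def)
qed

text \<open>
  Without a gap, the increasing numbers \<open>i\<^sub>1, \<dots>, i\<^sub>k, i\<^sub>1 + N\<close> would be consecutive, which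
  forces \<open>k = N\<close>.
\<close>

lemma gap_index_exists:
  assumes "I \<subseteq> {1..N}" "card I = k" "1 \<le> k" "k < N"
  shows "\<exists>l. gap_index N I l"
proof (rule ccontr)
  assume "\<not> ?thesis"
  then have "pos N I (l + 1) \<le> pos N I l + 1" if "l \<in> {1..k}" for l
    using that assms by (auto simp: gap_index_def not_less)
  moreover have "l \<le> k \<Longrightarrow> pos N I (l + 1) \<le> pos N I 1 + l" for l
  proof (induction l)
    case (Suc l)
    with calculation[of "Suc l"] show ?case by simp
  qed simp
  from this[of k] show False
    using pos_enumerates(3)[OF assms(1-3)] assms(4) by simp
qed

text \<open>
  The word is cut into the letters \<open>F\<close> outside \<open>I\<close>, which move the particles through the gaps, and the
  two blocks \<open>P\<close> and \<open>Q\<close> of letters of \<open>I\<close>, which start the particles. As \<open>F\<close> stands to the left,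
  the particles start first. Inside \<open>F\<close> two adjacent letters belong to the same descending block.
  Inside \<open>P\<close> and \<open>Q\<close> the letters ascend, so that the particle in front starts earlier; the particles
  \<open>i\<^sub>l\<close> and \<open>i\<^bsub>l+1\<^esub>\<close>, whose letters stand in the wrong order, are not adjacent by the
  choice of \<open>l\<close>. The alternatives \<open>z + N = x + 1\<close> and \<open>x + N = z + 1\<close> account for adjacency across
  the end of the window.
\<close>

lemma ahat_word_props:
  assumes "I \<subseteq> {1..N}" "card I = k" "1 \<le> k" and l: "gap_index N I l"
  defines "i \<equiv> pos N I"
  defines "u \<equiv> ahat_word N I l"
  shows "distinct u" "set u = {i 1..<i 1 + N}" "I \<subseteq> {i 1..<i 1 + N}"
    "sorted_wrt (\<lambda>x z. (z = x + 1 \<or> z + N = x + 1 \<longrightarrow> z \<in> I) \<and> (x = z + 1 \<or> x + N = z + 1 \<longrightarrow> x \<notin> I)) u"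
proof -
  note en = pos_enumerates[OF assms(1-3), folded i_def]
  have less: "i s < i t \<longleftrightarrow> s < t" if "s \<in> {1..k}" "t \<in> {1..k}" for s t
    using en(2) that by (metis strict_mono_on_less)
  have inI: "i s \<in> I" if "s \<in> {1..k}" for s using en(1) that by blast
  have iN: "1 \<le> i s \<and> i s \<le> N" if "s \<in> {1..k}" for s
    using inI[OF that] assms(1) by auto
  have lk: "1 \<le> l" "l \<le> k" and gap: "i l + 1 < i (l + 1)"
    using l assms(2) by (auto simp: gap_index_def i_def)
  define F where "F = rev [i k + 1..<i 1 + N] @ concat (map (\<lambda>s. rev [i s + 1..<i (s + 1)]) [1..<k])"
  define P where "P = map i [l + 1..<k + 1]"
  define Q where "Q = map i [1..<l + 1]"
  have u: "u = F @ P @ Q"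
    by (simp add: u_def ahat_word_def Let_def F_def P_def Q_def i_def assms(2))
  have le: "i s \<le> i t \<longleftrightarrow> s \<le> t" if "s \<in> {1..k}" "t \<in> {1..k}" for s t
    using less[OF that(2,1)] by (meson not_le)
  have I_eq: "x \<in> I \<longleftrightarrow> (\<exists>s\<in>{1..k}. x = i s)" for x using en(1) by blast
  have k: "1 \<in> {1..k}" "k \<in> {1..k}" "l \<in> {1..k}" using assms(3) lk by auto
  have rev_upt: "sorted_wrt (\<lambda>x z. z \<noteq> x + 1) (rev [a..<b])" for a b :: nat
    unfolding sorted_wrt_rev by (rule sorted_wrt_mono_rel[OF _ sorted_wrt_upt]) auto
  define G where "G m = concat (map (\<lambda>s. rev [i s + 1..<i (s + 1)]) [1..<m])" for m
  have G: "set (G m) = {i 1..<i m} - I \<and> distinct (G m) \<and> sorted_wrt (\<lambda>x z. z \<noteq> x + 1) (G m)"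
    if "1 \<le> m" "m \<le> k" for m
    using that
  proof (induction m rule: dec_induct)
    case base
    then show ?case by (simp add: G_def)
  next
    case (step m)
    have m: "m \<in> {1..k}" "Suc m \<in> {1..k}" using step by auto
    have Gm: "G (Suc m) = G m @ rev [i m + 1..<i (m + 1)]"
      using step by (simp add: G_def)
    have between: "x \<notin> I" if "i m < x" "x < i (Suc m)" for x
      using that less m by (auto simp: I_eq)
    have m1: "i 1 \<le> i m" "i m < i (Suc m)" "i m \<in> I" using le[of 1 m] less[of m "Suc m"] k m inI by auto
    have IH: "set (G m) = {i 1..<i m} - I" "distinct (G m)" "sorted_wrt (\<lambda>x z. z \<noteq> x + 1) (G m)"
      using step by auto
    have "x \<in> {i 1..<i (Suc m)} - I \<longleftrightarrow> x \<in> ({i 1..<i m} - I) \<union> {i m + 1..<i (m + 1)}" for x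
      using m1 between[of x] by (cases x "i m" rule: linorder_cases) auto
    then have "{i 1..<i (Suc m)} - I = ({i 1..<i m} - I) \<union> {i m + 1..<i (m + 1)}"
      by (rule Set.set_eqI)
    then have "set (G (Suc m)) = {i 1..<i (Suc m)} - I"
      unfolding Gm by (simp only: set_append IH(1) set_rev set_upt)
    moreover have "distinct (G (Suc m))"
      unfolding Gm using IH by auto
    moreover have "sorted_wrt (\<lambda>x z. z \<noteq> x + 1) (G (Suc m))"
      unfolding Gm sorted_wrt_append using IH rev_upt by auto
    ultimately show ?case by blast
  qed
  have G: "set (G k) = {i 1..<i k} - I" "distinct (G k)" "sorted_wrt (\<lambda>x z. z \<noteq> x + 1) (G k)"
    using G[of k] assms(3) by auto
  have F_eq: "F = rev [i k + 1..<i 1 + N] @ G k" by (simp add: F_def G_def)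
  have I_range: "i 1 \<le> x \<and> x \<le> i k" if "x \<in> I" for x
    using that le k by (auto simp: I_eq)
  have F: "set F = {i 1..<i 1 + N} - I"
  proof -
    have "i 1 \<le> i k" "i k \<in> I" "i k < i 1 + N" using I_range inI k iN[of k] iN[of 1] by auto
    then have "x \<in> {i 1..<i 1 + N} - I \<longleftrightarrow> x \<in> {i k + 1..<i 1 + N} \<union> ({i 1..<i k} - I)" for x
      using I_range[of x] by (cases x "i k" rule: linorder_cases) auto
    then have "{i 1..<i 1 + N} - I = {i k + 1..<i 1 + N} \<union> ({i 1..<i k} - I)"
      by (rule Set.set_eqI)
    then show ?thesis
      unfolding F_eq by (simp only: set_append G(1) set_rev set_upt)
  qed
  have "distinct F" "sorted_wrt (\<lambda>x z. z \<noteq> x + 1) F"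
    using G rev_upt unfolding F_eq sorted_wrt_append by auto
  have inj: "inj_on i {1..k}" using en(2) by (rule strict_mono_on_imp_inj_on)
  have PQ: "set P = i ` {l + 1..k}" "set Q = i ` {1..l}"
    by (auto simp: P_def Q_def)
  have "set P \<union> set Q = I"
    unfolding PQ en(1)[symmetric] image_Un[symmetric] using lk by (intro arg_cong[where f = "(`) i"]) auto
  moreover show "I \<subseteq> {i 1..<i 1 + N}" using I_range iN[of k] iN[of 1] k by fastforce
  ultimately show "set u = {i 1..<i 1 + N}"
    unfolding u by (auto simp: F)
  have "distinct P" "distinct Q"
    unfolding P_def Q_def distinct_map using lk
    by (intro conjI inj_on_subset[OF inj]; force)+
  moreover have "set P \<inter> set Q = i ` ({l + 1..k} \<inter> {1..l})"
    unfolding PQ using lk by (intro inj_on_image_Int[OF inj, symmetric]) auto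
  then have "set P \<inter> set Q = {}"
    by auto
  ultimately show "distinct u"
    unfolding u using \<open>distinct F\<close> \<open>set P \<union> set Q = I\<close> by (auto simp: F)
  define R where "R x z \<longleftrightarrow> (z = x + 1 \<or> z + N = x + 1 \<longrightarrow> z \<in> I) \<and> (x = z + 1 \<or> x + N = z + 1 \<longrightarrow> x \<notin> I)" for x z
  have "i 1 \<in> I" using inI k by blast
  have FF: "sorted_wrt R F"
    using \<open>sorted_wrt _ F\<close>
  proof (rule sorted_wrt_mono_rel[rotated])
    fix x z assume "x \<in> set F" "z \<in> set F" "z \<noteq> x + 1"
    moreover from this have "z \<noteq> i 1" using \<open>i 1 \<in> I\<close> F by auto
    ultimately show "R x z" by (auto simp: R_def F)
  qed
  have FPQ: "R x z" if "x \<in> set F" "z \<in> set P \<union> set Q" for x z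
    using that \<open>set P \<union> set Q = I\<close> by (auto simp: R_def F)
  have R_I: "R x z" if "x \<in> I" "z \<in> I" "x \<noteq> z + 1" "x + N \<noteq> z + 1" for x z
    using that by (auto simp: R_def)
  have PP: "sorted_wrt R P"
    unfolding P_def sorted_wrt_map
  proof (rule sorted_wrt_mono_rel[OF _ sorted_wrt_upt])
    fix s t assume "s \<in> set [l + 1..<k + 1]" "t \<in> set [l + 1..<k + 1]" "s < t"
    then have "s \<in> {1..k}" "t \<in> {1..k}" "1 < s" using lk by auto
    with less[of s t] \<open>s < t\<close> less[of 1 s] k iN[of t] iN[of 1] show "R (i s) (i t)"
      by (intro R_I inI) auto
  qed
  have QQ: "sorted_wrt R Q"
    unfolding Q_def sorted_wrt_map
  proof (rule sorted_wrt_mono_rel[OF _ sorted_wrt_upt])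
    fix s t assume "s \<in> set [1..<l + 1]" "t \<in> set [1..<l + 1]" "s < t"
    then have st: "s \<in> {1..k}" "t \<in> {1..k}" "t \<le> l" using lk by auto
    \<comment> \<open>Adjacency across the end of the window would mean \<open>i\<^sub>1 = 1\<close>, \<open>i\<^sub>l = N\<close>, \<open>l = k\<close>, so no gap at \<open>l\<close>.\<close>
    have "i s + N \<noteq> i t + 1"
    proof
      assume "i s + N = i t + 1"
      then have "i t = N" "i s = 1" using iN[OF st(1)] iN[OF st(2)] by auto
      then have "t = k"
        using le[of k t] iN[of k] st k by auto
      then have "l = k" "i l = N" "i 1 = 1"
        using \<open>i t = N\<close> \<open>i s = 1\<close> le[of 1 s] iN[of 1] st k lk by auto
      then show False using gap en(3) by simp
    qed
    with less[of s t] \<open>s < t\<close> st show "R (i s) (i t)"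
      by (intro R_I inI) auto
  qed
  have PQR: "R x z" if xz: "x \<in> set P" "z \<in> set Q" for x z
  proof -
    from xz obtain s t where st: "x = i s" "z = i t" "s \<in> {l + 1..k}" "t \<in> {1..l}"
      unfolding PQ by auto
    have "i t \<le> i l" "i (l + 1) \<le> i s" using st lk by (subst le; auto)+
    then have "z + 1 < x" using gap st by simp
    moreover have "z \<le> N" "1 \<le> z" using iN[of t] st lk by auto
    ultimately show ?thesis using st lk
      by (intro R_I) (auto intro: inI)
  qed
  have "sorted_wrt R u"
    unfolding u sorted_wrt_append using FF FPQ PP QQ PQR by auto
  then show "sorted_wrt (\<lambda>x z. (z = x + 1 \<or> z + N = x + 1 \<longrightarrow> z \<in> I) \<and> (x = z + 1 \<or> x + N = z + 1 \<longrightarrow> x \<notin> I)) u"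
    by (simp add: R_def[abs_def])
qed

lemma ahat_word_loop:
  fixes I :: "nat set"
  assumes I: "I \<subseteq> {1..CARD('n::nontriv)}" "card I = k" "1 \<le> k"
    and l: "gap_index CARD('n) I l"
  defines "w \<equiv> map of_nat (ahat_word CARD('n) I l) :: 'n mod_ring list"
  shows "run w (of_nat ` I) = Some (of_nat ` I)" "distinct w" "set w = UNIV"
proof -
  let ?N = "CARD('n)"
  define u where "u = ahat_word ?N I l"
  define a where "a = pos ?N I 1"
  note w_def' = w_def[folded u_def]
  note u = ahat_word_props[OF I l, folded a_def u_def]
  note inj = inj_on_of_nat_window[where 'n='n, of a]
  show w: "distinct w" "set w = UNIV"
    using u(1,2) inj of_nat_window_surj[where 'n='n, of a]
    by (simp_all only: w_def' distinct_map set_map simp_thms)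
  show "run w (of_nat ` I) = Some (of_nat ` I)"
  proof (rule run_loop_criterion[OF w])
    show "sorted_wrt (\<lambda>x z. (z = x + 1 \<longrightarrow> z \<in> of_nat ` I) \<and> (x = z + 1 \<longrightarrow> x \<notin> of_nat ` I)) w"
      unfolding w_def' sorted_wrt_map using u(4)
    proof (rule sorted_wrt_mono_rel[rotated])
      fix x z
      assume xz: "x \<in> set u" "z \<in> set u"
        and R: "(z = x + 1 \<or> z + ?N = x + 1 \<longrightarrow> z \<in> I) \<and> (x = z + 1 \<or> x + ?N = z + 1 \<longrightarrow> x \<notin> I)"
      have "of_nat x \<in> (of_nat ` I :: 'n mod_ring set) \<longleftrightarrow> x \<in> I"
        using inj_on_image_mem_iff[OF inj] xz u(2,3) by blast
      with R xz show "(of_nat z = (of_nat x + 1 :: 'n mod_ring) \<longrightarrow> of_nat z \<in> (of_nat ` I :: 'n mod_ring set)) \<and>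
          (of_nat x = (of_nat z + 1 :: 'n mod_ring) \<longrightarrow> of_nat x \<notin> (of_nat ` I :: 'n mod_ring set))"
        using of_nat_window_eq_Suc[where 'n='n, of x a z] of_nat_window_eq_Suc[where 'n='n, of z a x] u(2)
        by blast
    qed
  qed
qed


section \<open>The representation in terms of configurations\<close>

text \<open>
  The positions \<open>1, \<dots>, N\<close> represent \<open>\<int>/N\<close>, with \<open>N\<close> in the role of \<open>0\<close>.
\<close>

definition sites :: "'n::nontriv mod_ring set \<Rightarrow> nat set" where
  "sites X = {n \<in> {1..CARD('n)}. of_nat n \<in> X}"

lemma positions_eq_window: "{1..N} = {1..<1 + N}" for N :: nat
  by auto

lemma inj_on_of_nat_positions: "inj_on (of_nat :: nat \<Rightarrow> 'n::nontriv mod_ring) {1..CARD('n)}"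
  unfolding positions_eq_window by (rule inj_on_of_nat_window)

lemma of_nat_positions_surj: "(of_nat :: nat \<Rightarrow> 'n::nontriv mod_ring) ` {1..CARD('n)} = UNIV"
  unfolding positions_eq_window by (rule of_nat_window_surj)

lemma of_nat_sites: "of_nat ` sites X = (X :: 'n::nontriv mod_ring set)"
proof (intro subset_antisym subsetI)
  fix x assume "x \<in> X"
  have "x \<in> of_nat ` {1..CARD('n)}"
    by (simp only: of_nat_positions_surj UNIV_I)
  then obtain n where "n \<in> {1..CARD('n)}" "x = of_nat n"
    by (elim imageE)
  with \<open>x \<in> X\<close> show "x \<in> of_nat ` sites X"
    by (intro image_eqI[of _ _ n]) (simp_all add: sites_def)
qed (auto simp: sites_def)

lemma sites_of_nat:
  assumes "I \<subseteq> {1..CARD('n::nontriv)}"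
  shows "sites (of_nat ` I :: 'n mod_ring set) = I"
proof (rule Set.set_eqI)
  fix n
  have "n \<in> {1..CARD('n)} \<Longrightarrow> (of_nat n :: 'n mod_ring) \<in> of_nat ` I \<longleftrightarrow> n \<in> I"
    using inj_on_image_mem_iff[OF inj_on_of_nat_positions _ assms] by metis
  then show "n \<in> sites (of_nat ` I :: 'n mod_ring set) \<longleftrightarrow> n \<in> I"
    unfolding sites_def mem_Collect_eq using subsetD[OF assms, of n] by metis
qed

lemma sites_insert_diff:
  assumes "m \<in> {1..CARD('n::nontriv)}" "m' \<in> {1..CARD('n)}"
  shows "sites (insert (of_nat m') (X - {of_nat m :: 'n mod_ring})) = insert m' (sites X - {m})"
proof (rule Set.set_eqI)
  fix n
  have eq: "(of_nat n :: 'n mod_ring) = of_nat p \<longleftrightarrow> n = p"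
    if "n \<in> {1..CARD('n)}" "p \<in> {1..CARD('n)}" for p
    using inj_on_eq_iff[OF inj_on_of_nat_positions that] .
  show "n \<in> sites (insert (of_nat m') (X - {of_nat m})) \<longleftrightarrow> n \<in> insert m' (sites X - {m})"
    unfolding sites_def mem_Collect_eq insert_iff Diff_iff empty_iff
    using assms eq[OF _ assms(1)] eq[OF _ assms(2)] by metis
qed

lemma pscale_single [simp]:
  "pscale p (Poly_Mapping.single I c) = Poly_Mapping.single I (p * c)"
  by (simp add: pscale_def)

text \<open>
  The sign of a reordering is irrelevant below, because \<open>moves\<close> allows both signs.
\<close>

lemma wedge_distinct:
  assumes "distinct xs"
  shows "\<exists>e\<in>{1, -1}. wedge xs = Poly_Mapping.single (set xs) (e :: 'k::field poly)"
proof -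
  have "(- 1 :: 'k poly) ^ inversions xs \<in> {1, -1}"
    by (cases "even (inversions xs)") auto
  then show ?thesis
    using assms by (auto simp: wedge_def pvec_def)
qed

lemma wedge_not_distinct: "\<not> distinct xs \<Longrightarrow> wedge xs = 0"
  by (simp add: wedge_def)

text \<open>
  Both cases in the definition of \<open>act_basis\<close> replace one factor \<open>v\<^sub>m\<close> by \<open>v\<^bsub>j+1\<^esub>\<close>, where \<open>m = j\<close>
  for \<open>j > 0\<close>, and \<open>m = N\<close> for \<open>j = 0\<close>; in the latter case \<open>N\<close> is the last entry of the sorted list.
\<close>

lemma act_basis_sites:
  fixes X :: "'n::nontriv mod_ring set" and i :: "'n mod_ring"
  shows "\<exists>e\<in>{1, -1}. act_basis CARD('n) (nat (to_int_mod_ring i)) (sites X) =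
    (case hop i X of None \<Rightarrow> 0
      | Some Y \<Rightarrow> Poly_Mapping.single (sites Y) (e * (if i = 0 then qvar else 1 :: 'k::field poly)))"
proof -
  define j where "j = nat (to_int_mod_ring i)"
  have "to_int_mod_ring i \<in> {0..<CARD('n)}"
    using range_to_int_mod_ring[where 'a='n] by blast
  then have j: "j < CARD('n)" "i = of_nat j"
    by (auto simp: j_def nat_less_iff of_nat_of_int_mod_ring)
  \<comment> \<open>The position from which the particle starts.\<close>
  define m where "m = (if j = 0 then CARD('n) else j)"
  have m: "m \<in> {1..CARD('n)}" "j + 1 \<in> {1..CARD('n)}" "i = of_nat m" "i + 1 = of_nat (j + 1)"
    using j by (auto simp: m_def)
  then have m5: "m \<noteq> j + 1"
    by (metis add_cancel_right_right zero_neq_one)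
  have i0: "i = 0 \<longleftrightarrow> j = 0"
  proof -
    have "(of_nat j :: 'n mod_ring) = of_nat 0 \<longleftrightarrow> j = 0"
      unfolding of_nat_mod_ring_eq_iff using j(1) by (simp only: mod_less mod_0)
    then show ?thesis unfolding j(2) of_nat_0 .
  qed
  define I where "I = sites X"
  have fin: "finite I" "I \<subseteq> {1..CARD('n)}" by (auto simp: I_def sites_def)
  have mem: "i \<in> X \<longleftrightarrow> m \<in> I" "i + 1 \<in> X \<longleftrightarrow> j + 1 \<in> I"
    using m(1,2) unfolding I_def sites_def mem_Collect_eq by (metis m(3), metis m(4))
  define xs where "xs = sorted_list_of_set I"
  have xs: "set xs = I" "sorted_wrt (<) xs" "distinct xs"
    unfolding xs_def using fin(1) by (simp_all add: strict_sorted_list_of_set)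
  define f where "f = (\<lambda>n. if n = m then j + 1 else n)"
  have act: "act_basis CARD('n) j I =
    (if m \<in> I then pscale (if i = 0 then qvar else 1) (wedge (map f xs) :: 'k particle_space) else 0)"
  proof (cases "j = 0")
    case False
    have "pscale 1 x = x" for x :: "'k particle_space"
      by (rule poly_mapping_eqI) (simp add: pscale_def Poly_Mapping.map.rep_eq when_def)
    then show ?thesis
      using False by (simp add: act_basis_def xs_def m_def f_def i0)
  next
    case True
    have "butlast xs @ [1] = map f xs" if "m \<in> I"
    proof -
      have "xs \<noteq> []" using that xs(1) by force
      then obtain ys z where ys: "xs = ys @ [z]"
        by (cases xs rule: rev_cases) simp_all
      have "\<forall>y\<in>set ys. y < z" using xs(2) by (simp add: ys sorted_wrt_append)
      moreover have "z \<le> m" using fin(2) xs(1) True by (auto simp: ys m_def)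
      moreover have "m \<in> insert z (set ys)" using that xs(1) by (auto simp: ys)
      ultimately have "z = m" "m \<notin> set ys" by auto
      then have "map f ys = ys" by (intro map_idI) (auto simp: f_def)
      then show ?thesis using \<open>z = m\<close> True by (simp add: ys f_def)
    qed
    then show ?thesis
      using True by (simp add: act_basis_def xs_def[symmetric] m_def i0)
  qed
  show ?thesis
  proof (cases "m \<in> I \<and> j + 1 \<notin> I")
    case True
    have "inj_on f I"
      using True by (auto simp: inj_on_def f_def)
    then have "distinct (map f xs)" by (simp add: distinct_map xs)
    from wedge_distinct[OF this, where 'k='k] obtain e :: "'k poly"
      where e: "e \<in> {1, -1}" "wedge (map f xs) = Poly_Mapping.single (f ` I) e"
      by (auto simp: xs(1))
    have "f ` I = insert (j + 1) (I - {m})"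
      using True by (auto simp: f_def)
    also have "\<dots> = sites (insert (i + 1) (X - {i}))"
      using sites_insert_diff[OF m(1,2), of X, folded m(3,4)] by (simp only: I_def)
    finally show ?thesis
      using e True mem act unfolding I_def[symmetric] j_def[symmetric]
      by (intro bexI[of _ e]) (auto simp: hop_def mult.commute)
  next
    case False
    have "wedge (map f xs) = (0 :: 'k particle_space)" if "m \<in> I" "j + 1 \<in> I"
    proof (rule wedge_not_distinct)
      have "f m = f (j + 1)" by (simp add: f_def)
      then show "\<not> distinct (map f xs)"
        using that m5 by (auto simp: distinct_map xs(1) inj_on_def)
    qed
    moreover have "pscale p 0 = (0 :: 'k particle_space)" for p
      using pscale_single[of p "{}" 0] by simp
    ultimately have "act_basis CARD('n) j I = (0 :: 'k particle_space)"
      using False act by auto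
    then show ?thesis
      using False mem unfolding I_def[symmetric] j_def[symmetric]
      by (auto simp: hop_def)
  qed
qed

lemma act_gen_single:
  "p \<noteq> 0 \<Longrightarrow> act_gen (i :: 'n::nontriv mod_ring) (Poly_Mapping.single I p) =
    pscale p (act_basis CARD('n) (nat (to_int_mod_ring i)) I)"
  by (simp add: act_gen_def)

lemma act_word_sites:
  fixes X :: "'n::nontriv mod_ring set"
  shows "\<exists>e\<in>{1, -1}. act_word w (pvec (sites X)) =
    (case run w X of None \<Rightarrow> 0
      | Some Y \<Rightarrow> Poly_Mapping.single (sites Y) (e * qvar ^ count_list w 0 :: 'k::field poly))"
proof (induction w)
  case Nil
  then show ?case by (auto simp: act_word_def pvec_def)
next
  case (Cons i w)
  then obtain e :: "'k poly" where e: "e \<in> {1, -1}" "act_word w (pvec (sites X)) =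
    (case run w X of None \<Rightarrow> 0 | Some Y \<Rightarrow> Poly_Mapping.single (sites Y) (e * qvar ^ count_list w 0))"
    by blast
  have Cons_act: "act_word (i # w) (pvec (sites X)) = act_gen i (act_word w (pvec (sites X)) :: 'k particle_space)"
    by (simp add: act_word_def)
  show ?case
  proof (cases "run w X")
    case None
    then show ?thesis
      using e by (intro bexI[of _ 1]) (auto simp: Cons_act act_gen_def)
  next
    case (Some Z)
    obtain e' :: "'k poly" where e': "e' \<in> {1, -1}" "act_basis CARD('n) (nat (to_int_mod_ring i)) (sites Z) =
      (case hop i Z of None \<Rightarrow> 0
        | Some Y \<Rightarrow> Poly_Mapping.single (sites Y) (e' * (if i = 0 then qvar else 1)))"
      using act_basis_sites[of i Z, where 'k='k] by blast
    have nz: "e * qvar ^ count_list w 0 \<noteq> 0"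
      using e(1) by (auto simp: qvar_def)
    have "pscale p 0 = (0 :: 'k particle_space)" for p
      using pscale_single[of p "{}" 0] by simp
    then have "act_word (i # w) (pvec (sites X)) = (case hop i Z of None \<Rightarrow> 0
        | Some Y \<Rightarrow> Poly_Mapping.single (sites Y) (e * e' * qvar ^ count_list (i # w) 0))"
      unfolding Cons_act e(2) Some option.case act_gen_single[OF nz] e'(2)
      by (auto split: option.split simp: algebra_simps)
    moreover have "e * e' \<in> {1, -1}" using e(1) e'(1) by auto
    ultimately show ?thesis using Some by (intro bexI[of _ "e * e'"]) auto
  qed
qed

text \<open>
  The coefficient \<open>\<plusminus>q\<^sup>r\<close> determines \<open>r\<close> as its degree, so the conditions on \<open>e\<^sub>I\<^sub>J\<close> do not depend on
  the field.
\<close>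

lemma moves_iff_has_type:
  fixes w :: "'n::nontriv mod_ring list"
  assumes I: "I \<subseteq> {1..CARD('n)}" and J: "J \<subseteq> {1..CARD('n)}"
  shows "moves TYPE('k::field) I J r w \<longleftrightarrow>
    has_type (of_nat ` J) (of_nat ` I) r w"
proof -
  obtain e :: "'k poly" where e: "e \<in> {1, -1}" "act_word w (pvec J) =
    (case run w (of_nat ` J) of None \<Rightarrow> 0
      | Some Y \<Rightarrow> Poly_Mapping.single (sites Y) (e * qvar ^ count_list w 0))"
    using act_word_sites[of w "of_nat ` J", where 'k='k] by (auto simp: sites_of_nat[OF J])
  have qd: "degree (qvar ^ m :: 'k poly) = m" for m
    by (simp add: qvar_def degree_power_eq)
  have q0: "(qvar ^ m :: 'k poly) \<noteq> 0" for m
    by (simp add: qvar_def)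
  have rhs: "pscale (qvar ^ r) (pvec I) = (Poly_Mapping.single I (qvar ^ r) :: 'k particle_space)"
    by (simp add: pvec_def)
  have eq_iff: "Poly_Mapping.single A (e * qvar ^ c) = (Poly_Mapping.single I (d * qvar ^ r) :: 'k particle_space)
      \<longleftrightarrow> A = I \<and> c = r \<and> e = d" if "d \<in> {1, -1}" for A c d
  proof
    assume eq: "Poly_Mapping.single A (e * qvar ^ c) = (Poly_Mapping.single I (d * qvar ^ r) :: 'k particle_space)"
    have "Poly_Mapping.keys (Poly_Mapping.single A (e * qvar ^ c)) = {A}"
      "Poly_Mapping.keys (Poly_Mapping.single I (d * qvar ^ r)) = {I}"
      using e(1) that q0 by auto
    with eq have A: "A = I" by simp
    with eq have "e * qvar ^ c = d * qvar ^ r"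
      by (metis lookup_single_eq)
    moreover from arg_cong[OF this, of degree] have "c = r"
      using e(1) that qd by auto
    ultimately show "A = I \<and> c = r \<and> e = d"
      using A q0[of r] by (metis mult_right_cancel)
  qed auto
  have "act_word w (pvec J) = pscale (qvar ^ r) (pvec I :: 'k particle_space) \<or>
      act_word w (pvec J) = - pscale (qvar ^ r) (pvec I :: 'k particle_space) \<longleftrightarrow>
      run w (of_nat ` J) = Some (of_nat ` I) \<and> count_list w 0 = r"
  proof (cases "run w (of_nat ` J)")
    case None
    have "Poly_Mapping.single I (qvar ^ r) \<noteq> (0 :: 'k particle_space)"
      using q0[of r] by (metis lookup_single_eq lookup_zero)
    with None show ?thesis by (simp add: e(2) rhs)
  next
    case (Some Y)
    have "sites Y = I \<longleftrightarrow> Y = of_nat ` I"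
      using of_nat_sites[of Y] sites_of_nat[OF I] by auto
    then show ?thesis
      using eq_iff[of 1 "sites Y" "count_list w 0"] eq_iff[of "-1" "sites Y" "count_list w 0"] e(1)
      by (auto simp: e(2) rhs Some single_uminus)
  qed
  then show ?thesis
    unfolding moves_def has_type_def by blast
qed


section \<open>Reachability of configurations\<close>

lemma card_sites: "card (sites X) = card X"
proof -
  have "inj_on (of_nat :: nat \<Rightarrow> 'a mod_ring) (sites X)"
    by (rule inj_on_subset[OF inj_on_of_nat_positions]) (auto simp: sites_def)
  then have "card ((of_nat :: nat \<Rightarrow> 'a mod_ring) ` sites X) = card (sites X)"
    by (rule card_image)
  then show ?thesis by (simp only: of_nat_sites)
qed

lemma sites_subset: "sites (X :: 'n::nontriv mod_ring set) \<subseteq> {1..CARD('n)}"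
  by (auto simp: sites_def)

lemma card_lt_if_proper: "X \<noteq> UNIV \<Longrightarrow> card (X :: 'n::nontriv mod_ring set) < CARD('n)"
  using psubset_card_mono[of UNIV X] by auto

lemma loop_exists:
  fixes X :: "'n::nontriv mod_ring set"
  assumes "X \<noteq> {}" "X \<noteq> UNIV"
  shows "\<exists>w. run w X = Some X \<and> distinct w \<and> set w = UNIV"
proof -
  have "1 \<le> card X"
    using assms(1) by (simp add: Suc_le_eq card_gt_0_iff)
  note I = sites_subset card_sites this
  obtain l where "gap_index CARD('n) (sites X) l"
    using gap_index_exists[OF I card_lt_if_proper[OF assms(2)]] by blast
  from ahat_word_loop[OF I this] show ?thesis
    unfolding of_nat_sites by blast
qed

text \<open>
  Move the first occurrence of \<open>i\<close> in a loop at \<open>X\<close> to the very beginning; the rest of the loop then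
  leads back from \<open>X'\<close> to \<open>X\<close>.
\<close>

lemma run_hop_reversible:
  assumes "hop i X = Some X'"
  shows "\<exists>w. run w X' = Some X"
proof -
  have iX: "i \<in> X" "i + 1 \<notin> X" using assms by (auto simp: hop_eq_Some_iff)
  then have "X \<noteq> {}" "X \<noteq> UNIV" by auto
  then obtain w where w: "run w X = Some X" "set w = UNIV"
    using loop_exists by blast
  then have "i \<in> set w" by simp
  then obtain u v where uv: "w = u @ i # v" "i \<notin> set v"
    by (meson split_list_last)
  obtain Z where Z: "run v X = Some Z"
    using w(1) unfolding uv run_append_eq_Some_iff run_Cons_eq_Some_iff by blast
  have v: "\<And>j. j \<in> set v \<Longrightarrow> j \<noteq> i + 1 \<and> j \<noteq> i - 1"
    using run_blocked[OF Z iX uv(2)] by auto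
  have "run (u @ (i # v)) X = run (u @ (v @ [i])) X"
    by (simp only: run_append[of u] run_commute[OF v])
  then have "run (u @ v) X' = Some X"
    using w(1) assms unfolding uv by (simp add: run_append)
  then show ?thesis by blast
qed

lemma run_reversible:
  assumes "run w X = Some Y"
  shows "\<exists>w'. run w' Y = Some X"
  using assms
proof (induction w arbitrary: Y)
  case Nil
  then show ?case by (intro exI[of _ "[]"]) simp
next
  case (Cons i w)
  then obtain Z where Z: "run w X = Some Z" "hop i Z = Some Y"
    by (auto simp: bind_eq_Some_conv)
  then obtain u v where "run u Z = Some X" "run v Y = Some Z"
    using Cons.IH run_hop_reversible by meson
  then show ?case by (intro exI[of _ "u @ v"]) (simp add: run_append)
qed

lemma upward_closed_eq_interval:
  assumes "I \<subseteq> {1..N}" "I \<noteq> {}" "\<And>n. n \<in> I \<Longrightarrow> n < N \<Longrightarrow> n + 1 \<in> I"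
  shows "I = {N - card I + 1..N}"
proof -
  have fin: "finite I" using assms(1) finite_subset by blast
  define m where "m = Min I"
  have m: "m \<in> I" "\<And>n. n \<in> I \<Longrightarrow> m \<le> n" using fin assms(2) by (auto simp: m_def)
  have "n \<in> I" if "m \<le> n" "n \<le> N" for n
    using that by (induction n rule: dec_induct) (use m assms(3) in auto)
  with m assms(1) have "I = {m..N}" by auto
  moreover from this have "card I = N + 1 - m" by simp
  moreover have "1 \<le> m" "m \<le> N" using m assms(1) by auto
  ultimately show ?thesis by simp
qed

text \<open>
  As long as the particles do not fill the last sites up to \<open>N\<close>, one of them can move
  without crossing from \<open>N\<close> to \<open>1\<close>, which decreases the total distance to \<open>N\<close>. So all configurations
  with the same number of particles reach a common one, and by reversibility each other.
\<close>

lemma run_to_top: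
  fixes X :: "'n::nontriv mod_ring set"
  assumes "X \<noteq> {}"
  shows "\<exists>w. run w X = Some (of_nat ` {CARD('n) - card X + 1..CARD('n)})"
  using assms
proof (induction "\<Sum>n\<in>sites X. CARD('n) - n" arbitrary: X rule: less_induct)
  case less
  let ?N = "CARD('n)"
  note sub = sites_subset[of X]
  then have fin: "finite (sites X)" using finite_subset by blast
  have ne: "sites X \<noteq> {}" using less.prems of_nat_sites[of X] by auto
  show ?case
  proof (cases "\<exists>n\<in>sites X. n < ?N \<and> n + 1 \<notin> sites X")
    case False
    then have "sites X = {?N - card (sites X) + 1..?N}"
      using sub ne by (intro upward_closed_eq_interval) auto
    then have "X = of_nat ` {?N - card X + 1..?N}"
      using of_nat_sites[of X] by (simp only: card_sites)
    then show ?thesis by (intro exI[of _ "[]"]) simp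
  next
    case True
    then obtain n where n: "n \<in> sites X" "n < ?N" "n + 1 \<notin> sites X" by blast
    define Y where "Y = insert (of_nat (n + 1)) (X - {of_nat n})"
    have hop: "hop (of_nat n) X = Some Y"
      using n by (auto simp: hop_def Y_def sites_def algebra_simps)
    have sY: "sites Y = insert (n + 1) (sites X - {n})"
      unfolding Y_def using n sub by (intro sites_insert_diff) auto
    have "(\<Sum>n\<in>sites Y. ?N - n) = (?N - (n + 1)) + (\<Sum>n\<in>sites X - {n}. ?N - n)"
      unfolding sY using n fin by (intro sum.insert) auto
    also have "\<dots> < (?N - n) + (\<Sum>n\<in>sites X - {n}. ?N - n)"
      using n by simp
    also have "\<dots> = (\<Sum>n\<in>sites X. ?N - n)"
      using n(1) fin by (simp add: sum.remove)
    finally have "\<exists>w. run w Y = Some (of_nat ` {?N - card Y + 1..?N})"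
      by (rule less.hyps) (simp add: Y_def)
    moreover have run: "run [of_nat n] X = Some Y" using hop by simp
    ultimately obtain w where "run (w @ [of_nat n]) X = Some (of_nat ` {?N - card X + 1..?N})"
      using run_card[OF run] by (auto simp: run_append)
    then show ?thesis by blast
  qed
qed

text \<open>
  Starting with a full loop at \<open>X\<close> ensures that every particle is moved.
\<close>

lemma has_type_exists:
  fixes X Y :: "'n::nontriv mod_ring set"
  assumes "card X = card Y" "X \<noteq> {}" "X \<noteq> UNIV"
  shows "\<exists>r w. has_type X Y r w"
proof -
  have "Y \<noteq> {}" using assms by auto
  then obtain u v where "run u X = Some (of_nat ` {CARD('n) - card X + 1..CARD('n)})"
    "run v (of_nat ` {CARD('n) - card X + 1..CARD('n)}) = Some Y"
    using run_to_top[of X] run_to_top[of Y] run_reversible assms by metis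
  moreover obtain l where "run l X = Some X" "set l = UNIV"
    using loop_exists assms by blast
  ultimately have "has_type X Y (count_list (v @ u @ l) 0) (v @ u @ l)"
    by (auto simp: has_type_def run_append)
  then show ?thesis by blast
qed


section \<open>The basis\<close>

text \<open>
  The exponent of \<open>q\<close> produced by \<open>e\<^sub>I\<^sub>J\<close>, for \<open>J\<close> and \<open>I\<close> read as \<open>X\<close> and \<open>Y\<close>.
\<close>

definition min_winding :: "'n::nontriv mod_ring set \<Rightarrow> 'n mod_ring set \<Rightarrow> nat" where
  "min_winding X Y = (LEAST r. \<exists>w. has_type X Y r w)"

lemma min_winding_le: "has_type X Y r w \<Longrightarrow> min_winding X Y \<le> r"
  unfolding min_winding_def by (rule Least_le) blast

text \<open>
  In a loop all letters occur equally often, and some particle moves. So \<open>a(I)\<close>, where each letter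
  occurs once, attains the minimal winding; this is why \<open>e\<^sub>I\<^sub>I = a(I)\<close> fits the description of
  the other \<open>e\<^sub>I\<^sub>J\<close>.
\<close>

lemma has_type_loop_pos:
  assumes "has_type X X r w" "X \<noteq> {}"
  shows "1 \<le> r"
proof -
  have run: "run w X = Some X" "X \<subseteq> set w" "r = count_list w 0"
    using assms(1) by (auto simp: has_type_def)
  have "count_list w (of_nat n) = r" for n
  proof (induction n)
    case (Suc n)
    then show ?case using run_count[OF run(1), of "of_nat (Suc n)"] by simp
  qed (simp add: run(3))
  moreover obtain x where "x \<in> X" using assms(2) by blast
  moreover obtain n where "x = of_nat n" using mod_ring_eq_of_nat[of x] by blast
  ultimately show ?thesis using run(2) by (metis count_list_0_iff less_one not_le subsetD)
qed

lemma ahat_has_type: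
  fixes I :: "nat set"
  assumes "I \<subseteq> {1..CARD('n::nontriv)}" "card I = k" "1 \<le> k" "k < CARD('n)"
  shows "\<exists>w. (ahat I :: ('k::field, 'n) nTL) = nTL_monom w \<and> set w = UNIV \<and> has_type (of_nat ` I) (of_nat ` I) 1 w"
proof -
  define l where "l = (SOME l. gap_index CARD('n) I l)"
  define w where "w = (map of_nat (ahat_word CARD('n) I l) :: 'n mod_ring list)"
  have "gap_index CARD('n) I l"
    unfolding l_def using gap_index_exists[OF assms] by (rule someI_ex)
  note w = ahat_word_loop[OF assms(1-3) this, folded w_def]
  have "count_list w 0 = 1"
    using w(2,3) by (simp add: distinct_count_atmost_1 flip: count_mset)
  then have "has_type (of_nat ` I) (of_nat ` I) 1 w"
    using w by (simp add: has_type_def)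
  moreover have "(ahat I :: ('k, 'n) nTL) = nTL_monom w"
    by (simp add: ahat_def w_def l_def)
  ultimately show ?thesis using w(3) by blast
qed

lemma of_nat_image_nontrivial:
  assumes "I \<subseteq> {1..CARD('n::nontriv)}" "card I = k" "1 \<le> k" "k < CARD('n)"
  shows "card (of_nat ` I :: 'n mod_ring set) = k" "(of_nat ` I :: 'n mod_ring set) \<noteq> {}"
    "(of_nat ` I :: 'n mod_ring set) \<noteq> UNIV"
proof -
  show c: "card (of_nat ` I :: 'n mod_ring set) = k"
    using card_image[OF inj_on_subset[OF inj_on_of_nat_positions assms(1)]] assms(2) by blast
  show "(of_nat ` I :: 'n mod_ring set) \<noteq> {}"
    using assms(2,3) by auto
  show "(of_nat ` I :: 'n mod_ring set) \<noteq> UNIV"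
  proof
    assume "(of_nat ` I :: 'n mod_ring set) = UNIV"
    with c have "k = CARD('n)" by simp
    with assms(4) show False by simp
  qed
qed

lemma eIJ_has_type:
  fixes I J :: "nat set"
  assumes I: "I \<subseteq> {1..CARD('n::nontriv)}" "card I = k" and J: "J \<subseteq> {1..CARD('n)}" "card J = k"
    and k: "1 \<le> k" "k < CARD('n)"
  defines "X \<equiv> of_nat ` J :: 'n mod_ring set" and "Y \<equiv> of_nat ` I :: 'n mod_ring set"
  shows "\<exists>w. (eIJ I J :: ('k::field, 'n) nTL) = nTL_monom w \<and> has_type X Y (min_winding X Y) w"
proof (cases "I = J")
  case True
  obtain w where w: "(ahat I :: ('k, 'n) nTL) = nTL_monom w" "has_type X Y 1 w"
    using ahat_has_type[OF I k] unfolding X_def Y_def True by blast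
  have "X \<noteq> {}" unfolding X_def using of_nat_image_nontrivial[OF J k] by blast
  have "min_winding X Y = 1"
    unfolding min_winding_def
  proof (rule Least_equality)
    show "\<exists>w. has_type X Y 1 w" using w by blast
    show "1 \<le> r" if "\<exists>w. has_type X Y r w" for r
      using that has_type_loop_pos \<open>X \<noteq> {}\<close> unfolding X_def Y_def True by blast
  qed
  with w True show ?thesis by (auto simp: eIJ_def)
next
  case False
  note moves = moves_iff_has_type[OF I(1) J(1), where 'k='k, folded X_def Y_def]
  have ex: "\<exists>r w. has_type X Y r w"
    using of_nat_image_nontrivial[OF J k] of_nat_image_nontrivial[OF I k]
    unfolding X_def Y_def by (intro has_type_exists) auto
  have "\<exists>w. has_type X Y (min_winding X Y) w"
    unfolding min_winding_def by (rule LeastI_ex[OF ex])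
  then obtain w where w: "has_type X Y (min_winding X Y) w" ..
  have "(eIJ I J :: ('k, 'n) nTL) = nTL_monom w"
    unfolding eIJ_def if_not_P[OF False] moves
  proof (rule the_equality)
    show "\<exists>w' r. (nTL_monom w :: ('k, 'n) nTL) = nTL_monom w' \<and> has_type X Y r w' \<and>
        (\<forall>w' r'. has_type X Y r' w' \<longrightarrow> r \<le> r')"
      using w min_winding_le by blast
    fix x :: "('k, 'n) nTL"
    assume "\<exists>w r. x = nTL_monom w \<and> has_type X Y r w \<and> (\<forall>w' r'. has_type X Y r' w' \<longrightarrow> r \<le> r')"
    then obtain w' r where w': "x = nTL_monom w'" "has_type X Y r w'" "r \<le> min_winding X Y"
      using w by blast
    then have "r = min_winding X Y" using min_winding_le by (meson le_antisym)
    with w w' show "x = nTL_monom w"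
      unfolding has_type_def by (metis run_monom_determined)
  qed
  with w show ?thesis by blast
qed

lemma minus_one_power_commute: "x * (- 1) ^ m = (- 1) ^ m * (x :: 'a::ring_1)"
  by (cases "even m") simp_all

lemma minus_one_power_square: "(- 1) ^ m * (- 1) ^ m = (1 :: 'a::ring_1)"
  by (cases "even m") simp_all

text \<open>
  The loop \<open>a(I')\<close> touches every site and is executable from \<open>I'\<close> only. If \<open>a(I') w\<close> were nonzero for a
  word \<open>w\<close> of type \<open>(X, I, r)\<close>, it would be executable from some configuration; this contains \<open>X\<close> and
  has the same number of particles, hence it is \<open>X\<close>, and \<open>w\<close> leads to \<open>I\<close>, so that \<open>I' = I\<close>. Thus only
  the summand \<open>a(I)\<close> of \<open>t\<^sub>k\<close> contributes.
\<close>

lemma tk_mult_monom: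
  fixes I :: "nat set"
  assumes I: "I \<subseteq> {1..CARD('n::nontriv)}" "card I = k" and k: "1 \<le> k" "k < CARD('n)"
    and w: "has_type X (of_nat ` I) r w"
  shows "\<exists>w'. has_type X (of_nat ` I) (r + 1) w' \<and>
    tk k * nTL_monom w = (- 1) ^ (k - 1) * (nTL_monom w' :: ('k::field, 'n) nTL)"
proof -
  let ?S = "subsets_of_card CARD('n) k"
  have "?S \<subseteq> Pow {1..CARD('n)}" by (auto simp: subsets_of_card_def)
  then have fin: "finite ?S" by (rule finite_subset) simp
  have IS: "I \<in> ?S" using I by (simp add: subsets_of_card_def)
  have run_w: "run w X = Some (of_nat ` I)" "X \<subseteq> set w" using w by (auto simp: has_type_def)
  have zero: "ahat I' * nTL_monom w = (0 :: ('k, 'n) nTL)" if I': "I' \<in> ?S" "I' \<noteq> I" for I'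
  proof (rule ccontr)
    assume nz: "ahat I' * nTL_monom w \<noteq> (0 :: ('k, 'n) nTL)"
    have sub: "I' \<subseteq> {1..CARD('n)}" "card I' = k" using I' by (auto simp: subsets_of_card_def)
    obtain v where v: "(ahat I' :: ('k, 'n) nTL) = nTL_monom v" "set v = UNIV"
      "has_type (of_nat ` I') (of_nat ` I') 1 v"
      using ahat_has_type[OF sub k] by blast
    from nz have "nTL_monom (v @ w) \<noteq> (0 :: ('k, 'n) nTL)" by (simp add: v(1))
    from nTL_monom_nonzero_imp_run[OF this] obtain X' Z Y' where
      Z: "run w X' = Some Z" "run v Z = Some Y'"
      by (auto simp: run_append_eq_Some_iff)
    have Z_eq: "Z = of_nat ` I'"
      using run_sites_agree[OF Z(2), of "of_nat ` I'"] v(2,3) by (auto simp: has_type_def)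
    have "X \<subseteq> X'"
      using run_sites_agree[OF run_w(1) Z(1)] run_w(2) by blast
    moreover have "card X' = card X"
      using run_card[OF Z(1)] run_card[OF run_w(1)]
        of_nat_image_nontrivial(1)[OF I k] of_nat_image_nontrivial(1)[OF sub k] Z_eq by simp
    ultimately have "X = X'" by (intro card_subset_eq) auto
    with Z run_w Z_eq have "(of_nat ` I' :: 'n mod_ring set) = of_nat ` I" by simp
    then have "I' = I"
      using sites_of_nat[OF I(1)] sites_of_nat[OF sub(1)] by metis
    with I' show False by simp
  qed
  obtain v where v: "(ahat I :: ('k, 'n) nTL) = nTL_monom v" "has_type (of_nat ` I) (of_nat ` I) 1 v"
    using ahat_has_type[OF I k] by blast
  have "(\<Sum>I'\<in>?S. ahat I' * nTL_monom w :: ('k, 'n) nTL) = ahat I * nTL_monom w"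
    using zero by (subst sum.remove[OF fin IS]) (simp add: sum.neutral)
  then have "tk k * nTL_monom w = (- 1) ^ (k - 1) * (nTL_monom (v @ w) :: ('k, 'n) nTL)"
    by (simp add: tk_def mult.assoc sum_distrib_right v(1))
  moreover have "has_type X (of_nat ` I) (r + 1) (v @ w)"
    using w v(2) by (auto simp: has_type_def run_append)
  ultimately show ?thesis by blast
qed

lemma tk_power_eIJ:
  fixes I J :: "nat set"
  assumes I: "I \<subseteq> {1..CARD('n::nontriv)}" "card I = k" and J: "J \<subseteq> {1..CARD('n)}" "card J = k"
    and k: "1 \<le> k" "k < CARD('n)"
  defines "X \<equiv> of_nat ` J :: 'n mod_ring set" and "Y \<equiv> of_nat ` I :: 'n mod_ring set"
  shows "\<exists>w. has_type X Y (min_winding X Y + l) w \<and>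
    tk k ^ l * eIJ I J = (- 1) ^ ((k - 1) * l) * (nTL_monom w :: ('k::field, 'n) nTL)"
proof (induction l)
  case 0
  show ?case using eIJ_has_type[OF I J k, where 'k='k] unfolding X_def Y_def by auto
next
  case (Suc l)
  then obtain w where w: "has_type X Y (min_winding X Y + l) w"
    "tk k ^ l * eIJ I J = (- 1) ^ ((k - 1) * l) * (nTL_monom w :: ('k, 'n) nTL)" by blast
  obtain w' where w': "has_type X Y (min_winding X Y + l + 1) w'"
    "tk k * nTL_monom w = (- 1) ^ (k - 1) * (nTL_monom w' :: ('k, 'n) nTL)"
    using tk_mult_monom[OF I k, of X] w(1) unfolding Y_def by blast
  have "tk k ^ Suc l * eIJ I J = tk k * (- 1) ^ ((k - 1) * l) * (nTL_monom w :: ('k, 'n) nTL)"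
    by (simp add: mult.assoc w(2))
  also have "\<dots> = (- 1) ^ ((k - 1) * l) * (tk k * nTL_monom w)"
    by (simp only: minus_one_power_commute mult.assoc)
  also have "\<dots> = (- 1) ^ ((k - 1) * Suc l) * nTL_monom w'"
    by (simp only: w'(2) mult_Suc_right add.commute[of "k - 1"] power_add mult.assoc)
  finally show ?case using w'(1) by (intro exI[of _ w']) simp
qed

theorem theorem7p4:
  fixes B :: "('k::field, 'n::nontriv) nTL set"
  assumes N: "CARD('n) \<ge> 3"
    and B: "B = {1} \<union> {tk k ^ l * eIJ I J | k l I J.
              1 \<le> k \<and> k \<le> CARD('n) - 1 \<and>
              I \<in> subsets_of_card CARD('n) k \<and> J \<in> subsets_of_card CARD('n) k}"
  shows "(\<forall>k l I J. 1 \<le> k \<and> k \<le> CARD('n) - 1 \<and>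
              I \<in> subsets_of_card CARD('n) k \<and> J \<in> subsets_of_card CARD('n) k \<longrightarrow>
            (\<exists>w. tk k ^ l * eIJ I J =
              (- 1) ^ ((k - 1) * l) * (nTL_monom w :: ('k, 'n) nTL))) \<and>
         nTL.independent B \<and> nTL.span B = UNIV"
proof (intro conjI)
  define adm where "adm k I J \<longleftrightarrow> 1 \<le> k \<and> k \<le> CARD('n) - 1 \<and>
    I \<in> subsets_of_card CARD('n) k \<and> J \<in> subsets_of_card CARD('n) k" for k and I J :: "nat set"
  define im where "im I = (of_nat ` I :: 'n mod_ring set)" for I :: "nat set"
  have admD: "I \<subseteq> {1..CARD('n)}" "card I = k" "J \<subseteq> {1..CARD('n)}" "card J = k" "1 \<le> k" "k < CARD('n)"
    if "adm k I J" for k I J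
    using that N by (auto simp: adm_def subsets_of_card_def)
  have elem: "\<exists>w. has_type (im J) (im I) (min_winding (im J) (im I) + l) w \<and>
      tk k ^ l * eIJ I J = (- 1) ^ ((k - 1) * l) * (nTL_monom w :: ('k, 'n) nTL)"
    if "adm k I J" for k l I J
    unfolding im_def by (rule tk_power_eIJ[OF admD[OF that]])
  have sites_im: "sites (im J) = J" "sites (im I) = I" "im J \<noteq> {}" if "adm k I J" for k I J
    using admD[OF that] of_nat_image_nontrivial(2)[of J k, where 'n='n] sites_of_nat[where 'n='n]
    unfolding im_def by auto
  show "\<forall>k l I J. 1 \<le> k \<and> k \<le> CARD('n) - 1 \<and>
              I \<in> subsets_of_card CARD('n) k \<and> J \<in> subsets_of_card CARD('n) k \<longrightarrow>
            (\<exists>w. tk k ^ l * eIJ I J =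
              (- 1) ^ ((k - 1) * l) * (nTL_monom w :: ('k, 'n) nTL))"
    using elem unfolding adm_def by blast
  have B_cases: "b \<in> B \<longleftrightarrow> b = 1 \<or> (\<exists>k l I J. adm k I J \<and> b = tk k ^ l * eIJ I J)" for b
    unfolding B adm_def by blast
  define P :: "('k, 'n) nTL \<Rightarrow> 'n mod_ring set \<Rightarrow> 'n mod_ring set \<Rightarrow> nat \<Rightarrow> bool" where
    "P b X Y r \<longleftrightarrow> b = 1 \<and> X = {} \<and> Y = {} \<and> r = 0 \<or>
      (\<exists>k l I J. adm k I J \<and> b = tk k ^ l * eIJ I J \<and> X = im J \<and> Y = im I \<and>
        r = min_winding (im J) (im I) + l)" for b X Y r
  show "nTL.independent B"
  proof (rule nTL_independent_if_distinct_types[OF N, where P = P])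
    fix b assume "b \<in> B"
    then consider "b = 1" | k l I J where "adm k I J" "b = tk k ^ l * eIJ I J"
      unfolding B_cases by blast
    then show "\<exists>X Y r m w. P b X Y r \<and> has_type X Y r w \<and> b = (- 1) ^ m * nTL_monom w"
    proof cases
      case 1
      then have "P b {} {} 0 \<and> has_type {} {} 0 [] \<and> b = (- 1) ^ 0 * nTL_monom []"
        by (simp add: P_def has_type_Nil_iff)
      then show ?thesis by blast
    next
      case (2 k l I J)
      then have "P b (im J) (im I) (min_winding (im J) (im I) + l)"
        unfolding P_def by blast
      with elem[OF 2(1), of l] 2(2) show ?thesis by blast
    qed
  next
    fix b b' X Y r assume "P b X Y r" "P b' X Y r"
    then consider "b = 1" "b' = 1"
      | k l I J k' l' I' J' where "adm k I J" "b = tk k ^ l * eIJ I J" "adm k' I' J'"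
          "b' = tk k' ^ l' * eIJ I' J'" "im J = im J'" "im I = im I'"
          "min_winding (im J) (im I) + l = min_winding (im J') (im I') + l'"
      using sites_im(3) unfolding P_def by metis
    then show "b = b'"
    proof cases
      case (2 k l I J k' l' I' J')
      have "J = J'" using sites_im(1)[OF 2(1)] sites_im(1)[OF 2(3)] 2(5) by metis
      moreover have "I = I'" using sites_im(2)[OF 2(1)] sites_im(2)[OF 2(3)] 2(6) by metis
      moreover from this have "k = k'" using admD(2)[OF 2(1)] admD(2)[OF 2(3)] by metis
      moreover have "l = l'" using 2(5-7) by (metis add_left_cancel)
      ultimately show ?thesis using 2(2,4) by metis
    qed metis
  qed
  have "nTL_monom w \<in> nTL.span B" for w :: "'n mod_ring list"
  proof (cases "nTL_monom w = (0 :: ('k, 'n) nTL) \<or> w = []")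
    case True
    then show ?thesis by (auto simp: B nTL.span_zero intro: nTL.span_base)
  next
    case False
    then obtain X Y where XY: "run w X = Some Y" "X \<subseteq> set w"
      using nTL_monom_nonzero_imp_run[of w, where 'k='k] by blast
    have X: "X \<noteq> {}" "X \<noteq> UNIV" using run_proper_nonempty[OF XY(1)] False by auto
    define k r where "k = card X" and "r = count_list w 0"
    have type: "has_type X Y r w" using XY by (simp add: has_type_def r_def)
    have adm: "adm k (sites Y) (sites X)"
      using X card_lt_if_proper[OF X(2)] run_card[OF XY(1)]
      by (auto simp: adm_def subsets_of_card_def k_def card_sites Suc_le_eq card_gt_0_iff)
        (auto simp: sites_def)
    define l where "l = r - min_winding X Y"
    have l: "min_winding X Y + l = r" using min_winding_le[OF type] by (simp add: l_def)
    have im: "im (sites X) = X" "im (sites Y) = Y" by (simp_all add: im_def of_nat_sites)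
    obtain w' where w': "has_type X Y r w'"
      "tk k ^ l * eIJ (sites Y) (sites X) = (- 1) ^ ((k - 1) * l) * (nTL_monom w' :: ('k, 'n) nTL)"
      using elem[OF adm, of l] unfolding im l by blast
    have "nTL_monom w = (nTL_monom w' :: ('k, 'n) nTL)"
      using type w'(1) unfolding has_type_def by (metis run_monom_determined)
    also have "\<dots> = (- 1) ^ ((k - 1) * l) * ((- 1) ^ ((k - 1) * l) * nTL_monom w')"
      by (simp only: mult.assoc[symmetric] minus_one_power_square mult_1_left)
    also have "\<dots> = nTL_scale ((- 1) ^ ((k - 1) * l)) (tk k ^ l * eIJ (sites Y) (sites X))"
      by (simp only: w'(2) nTL_scale_minus_one_power)
    also have "\<dots> \<in> nTL.span B"
      using adm B_cases by (intro nTL.span_scale nTL.span_base) blast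
    finally show ?thesis .
  qed
  then have "nTL.span (range nTL_monom) \<subseteq> nTL.span B"
    by (intro nTL.span_minimal) auto
  then show "nTL.span B = UNIV" by (simp add: nTL_monoms_span top.extremum_unique)
qed

end
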